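(* For any $s>0$, there exist separable complex Hilbert spaces $X$ and $Y$, a compact set $\mathcal{K}\subset X$, an open set $\mathcal{O}\subset X$ containing $\mathcal{K}$, and a holomorphic map $u:\mathcal{O}\to Y$ such that: (i) $u$ is the restriction to $\mathcal{O}$ of a continuous two-homogeneous polynomial on $X$; (ii) $u$ is uniformly bounded on $\mathcal{O}$; (iii) $d_n(\mathcal{K})_X \asymp n^{-s}$ and $d_n(u(\mathcal{K}))_Y\asymp n^{-s}\bigl(\log(n+1)\bigr)^s$ for $n\ge1$.
   Context: For a compact subset $\mathcal{A}$ of a Banach space $Z$ and an integer $n\ge 1$, the Kolmogorov $n$-width is $$d_n(\mathcal{A})_Z:=\inf_{\substack{V_n\subset Z\\ \dim V_n\le n}}\ \sup_{a\in\mathcal{A}}\ \inf_{v\in V_n}\|a-v\|_Z,$$ where $V_n$ ranges over linear subspaces of $Z$ of dimension at most $n$. For nonnegative sequences $(a_n)_{n\ge1}$, $(b_n)_{n\ge1}$, $a_n\asymp b_n$ means there are constants $0<c\le C<\infty$, independent of $n$, with $c\,b_n\le a_n\le C\,b_n$ for all $n\ge1$. For $m\ge1$, a continuous $m$-homogeneous polynomial $P:X\to Y$ is a continuous map of the form $P(x)=A(x,\ldots,x)$ for some $m$-linear map $A:X^m\to Y$. A mapping $u:\mathcal{O}\to Y$ on an open set $\mathcal{O}\subset X$ is holomorphic if for every $a\in\mathcal{O}$ there exist an open ball $B_X(a,r)\subset\mathcal{O}$ and continuous $m$-homogeneous polynomials $P_{a,m}:X\to Y$, $m\ge1$, such that $u(x)=u(a)+\sum_{m=1}^\infty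 P_{a,m}(x-a)$ uniformly for $x\in B_X(a,r)$ (equivalently, $u$ is complex Fréchet differentiable on $\mathcal{O}$). *)

theory Defs
  imports "HOL-Analysis.Analysis" "HOL-Library.Function_Algebras"
begin

text \<open>
  A complex normed space is given by a complex linear subspace \<open>vecs X\<close> of an ambient vector space
  with carrier type \<open>'a::ab_group_add\<close> and scalar multiplication \<open>scl X\<close>, together with a norm
  that matters on \<open>vecs X\<close> only. Spaces are values rather than type-class instances, so that one
  can quantify over them inside a formula. The type \<open>nat \<Rightarrow> complex\<close> (with pointwise addition) has Hamel
  dimension continuum, so every separable complex Hilbert space is isomorphic to one whose vectors
  are drawn from it.
\<close>

record 'a cspace =
  vecs :: "'a set"
  scl :: "complex \<Rightarrow> 'a \<Rightarrow> 'a"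
  nrm :: "'a \<Rightarrow> real"

text \<open>
  The locale \<open>Metric_space\<close> requires nonnegativity and symmetry on the whole type, hence the
  default value outside \<open>vecs X\<close>.
\<close>

definition cdist :: "'a::ab_group_add cspace \<Rightarrow> 'a \<Rightarrow> 'a \<Rightarrow> real" where
  "cdist X x y = (if x \<in> vecs X \<and> y \<in> vecs X then nrm X (x - y) else 0)"

definition ctop :: "'a::ab_group_add cspace \<Rightarrow> 'a topology" where
  "ctop X = Metric_space.mtopology (vecs X) (cdist X)"

locale complex_normed_space = vector_space "scl X"
  for X :: "'a::ab_group_add cspace" +
  assumes subspace_vecs: "subspace (vecs X)"
    and nrm_eq_0_iff: "x \<in> vecs X \<Longrightarrow> nrm X x = 0 \<longleftrightarrow> x = 0"
    and nrm_scl: "x \<in> vecs X \<Longrightarrow> nrm X (scl X c x) = cmod c * nrm X x"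
    and nrm_triangle: "x \<in> vecs X \<Longrightarrow> y \<in> vecs X \<Longrightarrow> nrm X (x + y) \<le> nrm X x + nrm X y"
begin

lemma nrm_minus_commute:
  assumes "x \<in> vecs X" "y \<in> vecs X"
  shows "nrm X (x - y) = nrm X (y - x)"
proof -
  have "nrm X (scl X (-1) (y - x)) = cmod (-1) * nrm X (y - x)"
    using assms subspace_vecs by (intro nrm_scl subspace_diff)
  then show ?thesis by simp
qed

lemma nrm_nonneg:
  assumes "x \<in> vecs X"
  shows "0 \<le> nrm X x"
proof -
  have "nrm X (x + - x) \<le> nrm X x + nrm X (- x)"
    using assms subspace_vecs by (intro nrm_triangle subspace_neg)
  moreover have "nrm X (- x) = nrm X x"
    using nrm_minus_commute[of 0 x] assms subspace_vecs subspace_0 by simp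
  moreover have "nrm X 0 = 0"
    using nrm_eq_0_iff subspace_vecs subspace_0 by blast
  ultimately show ?thesis by simp
qed

lemma Metric_space_cdist: "Metric_space (vecs X) (cdist X)"
proof
  show "cdist X x z \<le> cdist X x y + cdist X y z"
    if "x \<in> vecs X" "y \<in> vecs X" "z \<in> vecs X" for x y z
    using that nrm_triangle[of "x - y" "y - z"] subspace_vecs
    by (simp add: cdist_def subspace_diff)
qed (use subspace_vecs in \<open>auto simp: cdist_def nrm_eq_0_iff nrm_nonneg subspace_diff
      intro: nrm_minus_commute\<close>)

end

locale complex_banach_space = complex_normed_space +
  assumes complete: "Metric_space.mcomplete (vecs X) (cdist X)"

text \<open>A Hilbert space is a Banach space whose norm is induced by an inner product.\<close>

definition inner_product_of :: "'a::ab_group_add cspace \<Rightarrow> ('a \<Rightarrow> 'a \<Rightarrow> complex) \<Rightarrow> bool" where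
  "inner_product_of X ip \<longleftrightarrow>
     (\<forall>x\<in>vecs X. \<forall>y\<in>vecs X. ip y x = cnj (ip x y)) \<and>
     (\<forall>x\<in>vecs X. \<forall>y\<in>vecs X. \<forall>z\<in>vecs X. ip (x + y) z = ip x z + ip y z) \<and>
     (\<forall>c. \<forall>x\<in>vecs X. \<forall>y\<in>vecs X. ip (scl X c x) y = c * ip x y) \<and>
     (\<forall>x\<in>vecs X. ip x x = complex_of_real ((nrm X x)\<^sup>2))"

locale complex_hilbert_space = complex_banach_space +
  assumes ex_inner_product: "\<exists>ip. inner_product_of X ip"

definition separable :: "'a::ab_group_add cspace \<Rightarrow> bool" where
  "separable X \<longleftrightarrow> separable_space (ctop X)"

text \<open>
  The Kolmogorov width. Since \<^const>\<open>vector_space.dim\<close> is \<open>0\<close> for infinite-dimensional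
  subspaces, finite-dimensionality is required separately. For nonempty bounded \<open>A\<close>, in particular
  for nonempty compact \<open>A\<close>, all infima and suprema are over nonempty bounded sets of reals.
\<close>

definition subspaces_dim_le :: "'a::ab_group_add cspace \<Rightarrow> nat \<Rightarrow> 'a set set" where
  "subspaces_dim_le Z n = {V. V \<subseteq> vecs Z \<and> module.subspace (scl Z) V \<and>
     (\<exists>B. finite B \<and> module.span (scl Z) B = V) \<and> vector_space.dim (scl Z) V \<le> n}"

definition kolmogorov_width :: "'a::ab_group_add cspace \<Rightarrow> 'a set \<Rightarrow> nat \<Rightarrow> real" where
  "kolmogorov_width Z A n =
     (INF V\<in>subspaces_dim_le Z n. SUP a\<in>A. INF v\<in>V. nrm Z (a - v))"

definition seq_comparable :: "(nat \<Rightarrow> real) \<Rightarrow> (nat \<Rightarrow> real) \<Rightarrow> bool" where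
  "seq_comparable a b \<longleftrightarrow>
     (\<exists>c C. 0 < c \<and> c \<le> C \<and> (\<forall>n\<ge>1. c * b n \<le> a n \<and> a n \<le> C * b n))"

text \<open>
  The elements of \<open>X\<^sup>m\<close> are the lists of length \<open>m\<close> over \<open>vecs X\<close>.
\<close>

definition multilinear_on ::
  "nat \<Rightarrow> 'a::ab_group_add cspace \<Rightarrow> 'b::ab_group_add cspace \<Rightarrow> ('a list \<Rightarrow> 'b) \<Rightarrow> bool" where
  "multilinear_on m X Y A \<longleftrightarrow>
     (\<forall>xs. length xs = m \<and> set xs \<subseteq> vecs X \<longrightarrow>
        A xs \<in> vecs Y \<and>
        (\<forall>k<m. \<forall>x\<in>vecs X. \<forall>y\<in>vecs X. A (xs[k := x + y]) = A (xs[k := x]) + A (xs[k := y])) \<and>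
        (\<forall>k<m. \<forall>c. \<forall>x\<in>vecs X. A (xs[k := scl X c x]) = scl Y c (A (xs[k := x]))))"

definition continuous_hom_poly ::
  "nat \<Rightarrow> 'a::ab_group_add cspace \<Rightarrow> 'b::ab_group_add cspace \<Rightarrow> ('a \<Rightarrow> 'b) \<Rightarrow> bool" where
  "continuous_hom_poly m X Y P \<longleftrightarrow>
     continuous_map (ctop X) (ctop Y) P \<and>
     (\<exists>A. multilinear_on m X Y A \<and> (\<forall>x\<in>vecs X. P x = A (replicate m x)))"

definition holomorphic_map ::
  "'a::ab_group_add cspace \<Rightarrow> 'b::ab_group_add cspace \<Rightarrow> 'a set \<Rightarrow> ('a \<Rightarrow> 'b) \<Rightarrow> bool" where
  "holomorphic_map X Y U u \<longleftrightarrow>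
     openin (ctop X) U \<and> u ` U \<subseteq> vecs Y \<and>
     (\<forall>a\<in>U. \<exists>r>0. \<exists>P.
        Metric_space.mball (vecs X) (cdist X) a r \<subseteq> U \<and>
        (\<forall>m\<ge>1. continuous_hom_poly m X Y (P m)) \<and>
        (\<forall>\<epsilon>>0. \<forall>\<^sub>F N in sequentially. \<forall>x\<in>Metric_space.mball (vecs X) (cdist X) a r.
           nrm Y (u x - (u a + (\<Sum>m=1..N. P m (x - a)))) < \<epsilon>))"

end

theory Submission
  imports Defs
begin

text \<open>
  Take \<open>X = Y = l2\<close> and let \<open>u(x)\<close> be the family of all products \<open>x\<^sub>2\<^sub>i x\<^sub>2\<^sub>j\<^sub>+\<^sub>1\<close>. The compact set \<open>K\<close>
  consists of the sums of a vector \<open>i\<^sup>-\<^sup>s e\<^sub>2\<^sub>i\<close> (or \<open>0\<close>) and a vector \<open>j\<^sup>-\<^sup>s e\<^sub>2\<^sub>j\<^sub>+\<^sub>1\<close> (or \<open>0\<close>), so that \<open>u(K)\<close> consists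
  of the vectors \<open>(i j)\<^sup>-\<^sup>s e\<^sub>i\<^sub>j\<close> and \<open>0\<close>. Up to constants, the width \<open>d\<^sub>n\<close> of a set of weighted orthonormal
  vectors is the \<open>n\<close>-th largest weight: the upper bound comes from coordinate subspaces, the lower
  bound from Bessel's inequality. For \<open>K\<close> this weight is of order \<open>n\<^sup>-\<^sup>s\<close>. For \<open>u(K)\<close> there are about
  \<open>N log N\<close> pairs in the hyperbolic cross \<open>i j \<le> N\<close>, so the \<open>n\<close>-th largest weight is of
  order \<open>(n / log n)\<^sup>-\<^sup>s\<close>.
\<close>

section \<open>Kolmogorov widths in inner product spaces\<close>

sublocale complex_normed_space \<subseteq> metric: Metric_space "vecs X" "cdist X"
  by (rule Metric_space_cdist)

context complex_normed_space
begin

lemmas vecs_closed = subspace_0[OF subspace_vecs] subspace_add[OF subspace_vecs]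
  subspace_diff[OF subspace_vecs] subspace_scale[OF subspace_vecs] subspace_sum[OF subspace_vecs]

lemma nrm_zero: "nrm X 0 = 0"
  using nrm_eq_0_iff vecs_closed(1) by blast

lemma cdist_nrm: "x \<in> vecs X \<Longrightarrow> y \<in> vecs X \<Longrightarrow> cdist X x y = nrm X (x - y)"
  by (simp add: cdist_def)

text \<open>Turns convergence in \<open>ctop X\<close> into a null sequence of reals, so that the
  limit calculus of the reals applies.\<close>

lemma limitin_ctop_iff:
  assumes "range x \<subseteq> vecs X" "l \<in> vecs X"
  shows "limitin (ctop X) x l sequentially \<longleftrightarrow> (\<lambda>n. nrm X (x n - l)) \<longlonglongrightarrow> 0"
proof -
  have "cdist X (x n) l = nrm X (x n - l)" for n
    using assms by (intro cdist_nrm) auto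
  then show ?thesis
    using assms by (auto simp: ctop_def metric.limitin_metric_dist_null image_subset_iff)
qed

text \<open>Sequential compactness: choose a subsequence along which the first summands converge,
  then a further one for the second summands. The compact set of the theorem is such a sum.\<close>

lemma compactin_set_plus:
  assumes "compactin (ctop X) S" "compactin (ctop X) T"
  shows "compactin (ctop X) {a + b |a b. a \<in> S \<and> b \<in> T}"
proof -
  have S: "S \<subseteq> vecs X" and T: "T \<subseteq> vecs X"
    using assms unfolding ctop_def metric.compactin_sequentially by auto
  show ?thesis
    unfolding ctop_def metric.compactin_sequentially
  proof (intro conjI allI impI)
    show "{a + b |a b. a \<in> S \<and> b \<in> T} \<subseteq> vecs X"
      using S T by (auto intro!: vecs_closed)
    fix \<sigma> :: "nat \<Rightarrow> 'a"
    assume "range \<sigma> \<subseteq> {a + b |a b. a \<in> S \<and> b \<in> T}"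
    then have "\<forall>n. \<exists>a b. \<sigma> n = a + b \<and> a \<in> S \<and> b \<in> T"
      by (auto simp: image_subset_iff)
    then obtain f g where fg: "\<And>n. \<sigma> n = f n + g n" "\<And>n. f n \<in> S" "\<And>n. g n \<in> T"
      by metis
    obtain l r where l: "l \<in> S" "strict_mono r" "limitin (ctop X) (f \<circ> r) l sequentially"
      using assms(1) fg(2) unfolding ctop_def metric.compactin_sequentially by blast
    have "range (g \<circ> r) \<subseteq> T"
      using fg(3) by auto
    then obtain l' r' where l': "l' \<in> T" "strict_mono r'"
        "limitin (ctop X) (g \<circ> r \<circ> r') l' sequentially"
      using assms(2) unfolding ctop_def metric.compactin_sequentially by blast
    have mem: "f n \<in> vecs X" "g n \<in> vecs X" "l \<in> vecs X" "l' \<in> vecs X" for n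
      using fg S T l(1) l'(1) by auto
    have "(\<lambda>n. nrm X (f (r n) - l)) \<longlonglongrightarrow> 0"
      using l(3) mem limitin_ctop_iff[of "f \<circ> r" l] by (auto simp: comp_def)
    from LIMSEQ_subseq_LIMSEQ[OF this l'(2)]
    have a: "(\<lambda>n. nrm X (f (r (r' n)) - l)) \<longlonglongrightarrow> 0"
      by (simp add: comp_def)
    have b: "(\<lambda>n. nrm X (g (r (r' n)) - l')) \<longlonglongrightarrow> 0"
      using l'(3) mem limitin_ctop_iff[of "g \<circ> r \<circ> r'" l'] by (auto simp: comp_def)
    have "(\<lambda>n. nrm X (\<sigma> (r (r' n)) - (l + l'))) \<longlonglongrightarrow> 0"
    proof (rule real_tendsto_sandwich[OF _ _ tendsto_const])
      show "\<forall>\<^sub>F n in sequentially. nrm X (\<sigma> (r (r' n)) - (l + l'))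
          \<le> nrm X (f (r (r' n)) - l) + nrm X (g (r (r' n)) - l')"
      proof (intro always_eventually allI)
        fix n
        have "\<sigma> (r (r' n)) - (l + l') = (f (r (r' n)) - l) + (g (r (r' n)) - l')"
          by (simp add: fg)
        then show "nrm X (\<sigma> (r (r' n)) - (l + l'))
            \<le> nrm X (f (r (r' n)) - l) + nrm X (g (r (r' n)) - l')"
          using mem by (simp only:) (intro nrm_triangle vecs_closed; simp)
      qed
      show "\<forall>\<^sub>F n in sequentially. 0 \<le> nrm X (\<sigma> (r (r' n)) - (l + l'))"
        using mem by (auto intro!: always_eventually nrm_nonneg vecs_closed simp: fg)
      show "(\<lambda>n. nrm X (f (r (r' n)) - l) + nrm X (g (r (r' n)) - l')) \<longlonglongrightarrow> 0"
        using tendsto_add[OF a b] by simp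
    qed
    then have "limitin (ctop X) (\<sigma> \<circ> (r \<circ> r')) (l + l') sequentially"
      using mem by (subst limitin_ctop_iff) (auto intro!: vecs_closed simp: comp_def fg)
    then show "\<exists>l r. l \<in> {a + b |a b. a \<in> S \<and> b \<in> T} \<and> strict_mono r
        \<and> limitin metric.mtopology (\<sigma> \<circ> r) l sequentially"
      using l(1,2) l'(1,2) unfolding ctop_def
      by (intro exI[of _ "l + l'"] exI[of _ "r \<circ> r'"]) (auto intro: strict_mono_o)
  qed
qed

lemma span_mem_subspaces_dim_le:
  assumes "finite B" "B \<subseteq> vecs X" "card B \<le> n"
  shows "span B \<in> subspaces_dim_le X n"
proof -
  have "dim (span B) \<le> card B"
    using assms(1) by (intro dim_le_card) auto
  then show ?thesis
    using assms span_minimal[OF assms(2) subspace_vecs]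
    by (auto simp: subspaces_dim_le_def)
qed

text \<open>The finite spanning set in the definition may have more than \<open>n\<close> elements.
  A basis of \<open>V\<close> has exactly \<open>dim V\<close> of them, and it is finite because an
  independent set inside a finite span is finite.\<close>

lemma subspaces_dim_leE:
  assumes "V \<in> subspaces_dim_le X n"
  obtains B where "finite B" "B \<subseteq> vecs X" "card B \<le> n" "V = span B"
proof -
  from assms obtain B0 where V: "V \<subseteq> vecs X" "subspace V" "finite B0" "span B0 = V" "dim V \<le> n"
    by (auto simp: subspaces_dim_le_def)
  obtain B where B: "B \<subseteq> V" "independent B" "V \<subseteq> span B" "card B = dim V"
    using basis_exists by blast
  have "finite B"
    using independent_span_bound[of B0 B] B V by auto
  moreover have "span B = V"
    using B V by (metis span_subspace)
  ultimately show ?thesis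
    using that B V by auto
qed

text \<open>Infima and suprema of reals behave well only on nonempty bounded sets. Distances to
  \<open>V\<close> lie between 0 and \<open>nrm X a\<close>, the upper bound coming from the
  approximant 0.\<close>

lemma dist_subspace_bdd:
  assumes "V \<in> subspaces_dim_le X n" "a \<in> vecs X"
  shows "bdd_below ((\<lambda>v. nrm X (a - v)) ` V)" and "0 \<in> V" and "(INF v\<in>V. nrm X (a - v)) \<le> nrm X a"
    and "0 \<le> (INF v\<in>V. nrm X (a - v))"
proof -
  have V: "V \<subseteq> vecs X" "subspace V"
    using assms by (auto simp: subspaces_dim_le_def)
  show bdd: "bdd_below ((\<lambda>v. nrm X (a - v)) ` V)"
    using V assms by (intro bdd_belowI[of _ 0]) (auto intro!: nrm_nonneg vecs_closed)
  show 0: "0 \<in> V"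
    using V subspace_0 by auto
  show "(INF v\<in>V. nrm X (a - v)) \<le> nrm X a"
    using cINF_lower[OF bdd 0] by simp
  show "0 \<le> (INF v\<in>V. nrm X (a - v))"
    using 0 V assms by (intro cINF_greatest) (auto intro!: nrm_nonneg vecs_closed)
qed

text \<open>The span of \<open>B\<close> is one competitor in the infimum. The norm bound
  \<open>M\<close> makes every supremum finite, so that 0 is a lower bound for the values of all
  competitors and the infimum lies below the value at \<open>B\<close>.\<close>

lemma kolmogorov_width_le:
  assumes A: "A \<subseteq> vecs X" "A \<noteq> {}" "\<And>a. a \<in> A \<Longrightarrow> nrm X a \<le> M"
    and B: "finite B" "B \<subseteq> vecs X" "card B \<le> n"
    and approx: "\<And>a. a \<in> A \<Longrightarrow> \<exists>v\<in>span B. nrm X (a - v) \<le> \<delta>"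
  shows "kolmogorov_width X A n \<le> \<delta>"
proof -
  obtain a0 where a0: "a0 \<in> A"
    using A by auto
  have bdd: "bdd_above ((\<lambda>a. INF v\<in>V. nrm X (a - v)) ` A)" if "V \<in> subspaces_dim_le X n" for V
    using dist_subspace_bdd(3)[OF that] A by (intro bdd_aboveI[of _ M]) force
  have "bdd_below ((\<lambda>V. SUP a\<in>A. INF v\<in>V. nrm X (a - v)) ` subspaces_dim_le X n)"
  proof (intro bdd_belowI[of _ 0], clarify)
    fix V assume V: "V \<in> subspaces_dim_le X n"
    have "0 \<le> (INF v\<in>V. nrm X (a0 - v))"
      using dist_subspace_bdd(4)[OF V] A a0 by auto
    also have "\<dots> \<le> (SUP a\<in>A. INF v\<in>V. nrm X (a - v))"
      by (rule cSUP_upper[OF a0 bdd[OF V]])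
    finally show "0 \<le> (SUP a\<in>A. INF v\<in>V. nrm X (a - v))" .
  qed
  moreover have V: "span B \<in> subspaces_dim_le X n"
    using B by (rule span_mem_subspaces_dim_le)
  ultimately have "kolmogorov_width X A n \<le> (SUP a\<in>A. INF v\<in>span B. nrm X (a - v))"
    unfolding kolmogorov_width_def by (intro cINF_lower)
  also have "\<dots> \<le> \<delta>"
  proof (rule cSUP_least[OF A(2)])
    fix a assume a: "a \<in> A"
    then obtain v where v: "v \<in> span B" "nrm X (a - v) \<le> \<delta>"
      using approx by blast
    have "(INF v\<in>span B. nrm X (a - v)) \<le> nrm X (a - v)"
      using dist_subspace_bdd(1)[OF V] a A v by (intro cINF_lower) auto
    with v show "(INF v\<in>span B. nrm X (a - v)) \<le> \<delta>"
      by simp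
  qed
  finally show ?thesis .
qed

text \<open>By \<open>subspaces_dim_leE\<close>, every competitor is spanned by at most
  \<open>n\<close> vectors, so it is enough to find a badly approximated point for each such finite
  set.\<close>

lemma kolmogorov_width_ge:
  assumes A: "A \<subseteq> vecs X" "\<And>a. a \<in> A \<Longrightarrow> nrm X a \<le> M"
    and far: "\<And>B. finite B \<Longrightarrow> B \<subseteq> vecs X \<Longrightarrow> card B \<le> n \<Longrightarrow>
      \<exists>a\<in>A. \<forall>v\<in>span B. \<delta> \<le> nrm X (a - v)"
  shows "\<delta> \<le> kolmogorov_width X A n"
  unfolding kolmogorov_width_def
proof (rule cINF_greatest)
  show "subspaces_dim_le X n \<noteq> {}"
    using span_mem_subspaces_dim_le[of "{}" n] by auto
  fix V assume V: "V \<in> subspaces_dim_le X n"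
  then obtain a where a: "a \<in> A" "\<And>v. v \<in> V \<Longrightarrow> \<delta> \<le> nrm X (a - v)"
    using far by (metis subspaces_dim_leE)
  have "\<delta> \<le> (INF v\<in>V. nrm X (a - v))"
    using dist_subspace_bdd(2)[OF V] A a by (intro cINF_greatest) auto
  also have "\<dots> \<le> (SUP a\<in>A. INF v\<in>V. nrm X (a - v))"
    using dist_subspace_bdd(3)[OF V] A a by (intro cSUP_upper bdd_aboveI[of _ M]) force+
  finally show "\<delta> \<le> (SUP a\<in>A. INF v\<in>V. nrm X (a - v))" .
qed

end

section \<open>Orthonormal systems, Bessel's inequality, and the lower bound for widths\<close>

locale complex_inner_space = complex_normed_space +
  fixes ip :: "'a \<Rightarrow> 'a \<Rightarrow> complex"
  assumes inner_product: "inner_product_of X ip"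
begin

lemma ip_commute: "x \<in> vecs X \<Longrightarrow> y \<in> vecs X \<Longrightarrow> ip y x = cnj (ip x y)"
  and ip_add_left: "x \<in> vecs X \<Longrightarrow> y \<in> vecs X \<Longrightarrow> z \<in> vecs X \<Longrightarrow> ip (x + y) z = ip x z + ip y z"
  and ip_scl_left: "x \<in> vecs X \<Longrightarrow> y \<in> vecs X \<Longrightarrow> ip (scl X c x) y = c * ip x y"
  and ip_self: "x \<in> vecs X \<Longrightarrow> ip x x = complex_of_real ((nrm X x)\<^sup>2)"
  using inner_product unfolding inner_product_of_def by blast+

lemma ip_diff_left:
  assumes "x \<in> vecs X" "y \<in> vecs X" "z \<in> vecs X"
  shows "ip (x - y) z = ip x z - ip y z"
  using ip_add_left[of "x - y" y z] assms by (simp add: vecs_closed)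

lemma ip_diff_right:
  assumes "x \<in> vecs X" "y \<in> vecs X" "z \<in> vecs X"
  shows "ip x (y - z) = ip x y - ip x z"
  using ip_diff_left[of y z x] assms ip_commute[of x] ip_commute[of _ x]
  by (metis complex_cnj_diff vecs_closed(3))

lemma ip_scl_right: "x \<in> vecs X \<Longrightarrow> y \<in> vecs X \<Longrightarrow> ip x (scl X c y) = cnj c * ip x y"
  using ip_scl_left[of y x c] ip_commute[of "scl X c y" x] ip_commute[of y x]
  by (simp add: vecs_closed)

text \<open>Completes the square in the coefficient \<open>a\<close>. This is the one-vector step of
  the induction in \<open>nrm_diff_orthonormal_sum\<close>.\<close>

lemma nrm_diff_scl_unit:
  assumes "x \<in> vecs X" "g \<in> vecs X" "nrm X g = 1"
  shows "(nrm X (x - scl X a g))\<^sup>2 = (nrm X x)\<^sup>2 - (cmod (ip x g))\<^sup>2 + (cmod (ip x g - a))\<^sup>2"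
proof -
  have "complex_of_real ((nrm X (x - scl X a g))\<^sup>2)
      = ip (x - scl X a g) (x - scl X a g)"
    using assms by (intro ip_self[symmetric] vecs_closed)
  also have "\<dots> = ip x x - cnj a * ip x g - a * cnj (ip x g) + a * cnj a * ip g g"
    using assms ip_commute[of x g]
    by (simp add: ip_diff_left ip_diff_right ip_scl_left ip_scl_right vecs_closed algebra_simps)
  also have "\<dots> = complex_of_real ((nrm X x)\<^sup>2) - ip x g * cnj (ip x g)
      + (ip x g - a) * cnj (ip x g - a)"
    using assms by (simp add: ip_self algebra_simps)
  also have "\<dots> = complex_of_real ((nrm X x)\<^sup>2 - (cmod (ip x g))\<^sup>2 + (cmod (ip x g - a))\<^sup>2)"
    by (simp only: complex_norm_square[symmetric] of_real_add of_real_diff)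
  finally show ?thesis
    by (simp only: of_real_eq_iff)
qed

definition orthonormal :: "'a set \<Rightarrow> bool" where
  "orthonormal F \<longleftrightarrow> F \<subseteq> vecs X \<and> (\<forall>f\<in>F. nrm X f = 1) \<and> (\<forall>f\<in>F. \<forall>g\<in>F. f \<noteq> g \<longrightarrow> ip f g = 0)"

lemma ip_sum_left:
  assumes "finite F" "F \<subseteq> vecs X" "g \<in> vecs X"
  shows "ip (\<Sum>f\<in>F. scl X (a f) f) g = (\<Sum>f\<in>F. a f * ip f g)"
  using assms
proof (induction F rule: finite_induct)
  case empty
  then show ?case
    using ip_diff_left[of 0 0 g] by (simp add: vecs_closed)
next
  case (insert h F)
  moreover from insert have "(\<Sum>f\<in>F. scl X (a f) f) \<in> vecs X"
    by (auto intro!: vecs_closed)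
  ultimately show ?case
    by (simp add: ip_add_left ip_scl_left vecs_closed)
qed

text \<open>Being an identity for arbitrary coefficients, it serves twice: the choice
  \<open>a f = ip x f\<close> gives Bessel's inequality, and discarding the last sum bounds the
  distance to the span from below. In the induction, the new vector is orthogonal to the partial
  sum, so subtracting that sum leaves its coefficient unchanged.\<close>

lemma nrm_diff_orthonormal_sum:
  assumes "finite F" "orthonormal F" "x \<in> vecs X"
  shows "(nrm X (x - (\<Sum>f\<in>F. scl X (a f) f)))\<^sup>2 =
    (nrm X x)\<^sup>2 - (\<Sum>f\<in>F. (cmod (ip x f))\<^sup>2) + (\<Sum>f\<in>F. (cmod (ip x f - a f))\<^sup>2)"
  using assms(1,2)
proof (induction F rule: finite_induct)
  case (insert g F)
  define y where "y = (\<Sum>f\<in>F. scl X (a f) f)"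
  have F: "orthonormal F" "F \<subseteq> vecs X" "g \<in> vecs X" "nrm X g = 1"
    using insert.prems by (auto simp: orthonormal_def)
  have y: "y \<in> vecs X"
    unfolding y_def using F by (auto intro!: vecs_closed)
  have "ip y g = 0"
    unfolding y_def using insert F by (subst ip_sum_left) (auto simp: orthonormal_def intro!: sum.neutral)
  then have "ip (x - y) g = ip x g"
    using y F assms by (simp add: ip_diff_left)
  then have "(nrm X (x - y - scl X (a g) g))\<^sup>2
      = (nrm X (x - y))\<^sup>2 - (cmod (ip x g))\<^sup>2 + (cmod (ip x g - a g))\<^sup>2"
    using nrm_diff_scl_unit[of "x - y" g "a g"] y F assms by (simp add: vecs_closed)
  moreover have "x - (\<Sum>f\<in>insert g F. scl X (a f) f) = x - y - scl X (a g) g"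
    using insert by (simp add: y_def algebra_simps)
  moreover have "(nrm X (x - y))\<^sup>2 =
      (nrm X x)\<^sup>2 - (\<Sum>f\<in>F. (cmod (ip x f))\<^sup>2) + (\<Sum>f\<in>F. (cmod (ip x f - a f))\<^sup>2)"
    unfolding y_def by (rule insert.IH[OF F(1)])
  ultimately show ?case
    using insert.hyps by (simp add: algebra_simps)
qed auto

lemma bessel:
  assumes "finite F" "orthonormal F" "x \<in> vecs X"
  shows "(\<Sum>f\<in>F. (cmod (ip x f))\<^sup>2) \<le> (nrm X x)\<^sup>2"
proof -
  have "0 \<le> (nrm X (x - (\<Sum>f\<in>F. scl X (ip x f) f)))\<^sup>2"
    by simp
  then show ?thesis
    unfolding nrm_diff_orthonormal_sum[OF assms] by simp
qed

lemma nrm_diff_span_orthonormal: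
  assumes "finite F" "orthonormal F" "x \<in> vecs X" "v \<in> span F"
  shows "(nrm X x)\<^sup>2 - (\<Sum>f\<in>F. (cmod (ip x f))\<^sup>2) \<le> (nrm X (x - v))\<^sup>2"
proof -
  obtain a where "v = (\<Sum>f\<in>F. scl X (a f) f)"
    using assms by (auto simp: span_finite)
  then show ?thesis
    using nrm_diff_orthonormal_sum[OF assms(1-3), of a] by (simp add: sum_nonneg)
qed

text \<open>Gram-Schmidt, one vector at a time: subtract from \<open>b\<close> its projection
  \<open>p\<close> and normalize the rest \<open>w\<close>, or keep \<open>F\<close> when
  \<open>w = 0\<close>. An inclusion of spans suffices, since enlarging the approximating space only
  strengthens a lower bound for the distance.\<close>

lemma ex_orthonormal_spanning:
  assumes "finite B" "B \<subseteq> vecs X"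
  shows "\<exists>F. finite F \<and> card F \<le> card B \<and> orthonormal F \<and> span B \<subseteq> span F"
  using assms
proof (induction B rule: finite_induct)
  case empty
  then show ?case
    by (intro exI[of _ "{}"]) (auto simp: orthonormal_def)
next
  case (insert b B)
  then obtain F where F: "finite F" "card F \<le> card B" "orthonormal F" "span B \<subseteq> span F"
    by auto
  have FX: "F \<subseteq> vecs X" and b: "b \<in> vecs X"
    using F insert by (auto simp: orthonormal_def)
  define p where "p = (\<Sum>f\<in>F. scl X (ip b f) f)"
  define w where "w = b - p"
  have p: "p \<in> span F"
    unfolding p_def by (intro span_sum span_scale span_base)
  have pX: "p \<in> vecs X"
    using p span_minimal[OF FX subspace_vecs] by auto
  then have wX: "w \<in> vecs X"
    using b by (simp add: w_def vecs_closed)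
  have orth: "ip w f = 0" if "f \<in> F" for f
  proof -
    have "ip p f = (\<Sum>g\<in>F. ip b g * ip g f)"
      unfolding p_def using F(1) FX that by (intro ip_sum_left) auto
    also have "\<dots> = (\<Sum>g\<in>F. if g = f then ip b f else 0)"
      using F(3) that by (intro sum.cong) (auto simp: orthonormal_def ip_self)
    finally have "ip p f = ip b f"
      using F(1) that by simp
    then show ?thesis
      using pX b FX that unfolding w_def by (subst ip_diff_left) auto
  qed
  show ?case
  proof (cases "w = 0")
    case True
    then have "b \<in> span F"
      using p by (simp add: w_def)
    then have "span (insert b B) \<subseteq> span F"
      using F(4) span_superset[of B] by (intro span_minimal) auto
    then show ?thesis
      using F insert by (intro exI[of _ F]) auto
  next
    case False
    define g where "g = scl X (inverse (of_real (nrm X w))) w"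
    have nw: "nrm X w \<noteq> 0"
      using False nrm_eq_0_iff wX by auto
    have gX: "g \<in> vecs X"
      using wX by (simp add: g_def vecs_closed)
    have ng: "nrm X g = 1"
      using nw wX nrm_nonneg[OF wX] by (simp add: g_def nrm_scl norm_inverse)
    have ipg: "ip g f = 0" if "f \<in> F" for f
      using orth[OF that] wX FX that by (auto simp: g_def ip_scl_left)
    have "orthonormal (insert g F)"
      using F(3) FX gX ng ipg ip_commute[OF gX] unfolding orthonormal_def by fastforce
    moreover have "span (insert b B) \<subseteq> span (insert g F)"
    proof (rule span_minimal)
      have "w = scl X (of_real (nrm X w)) g"
        using nw by (simp add: g_def)
      then have "w \<in> span (insert g F)"
        by (metis insertI1 span_base span_scale)
      moreover have *: "span F \<subseteq> span (insert g F)"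
        by (intro span_mono) auto
      ultimately have "w + p \<in> span (insert g F)"
        using p by (intro span_add) auto
      then show "insert b B \<subseteq> span (insert g F)"
        using * F(4) span_superset[of B] by (auto simp: w_def)
    qed auto
    moreover have "card (insert g F) \<le> card (insert b B)"
      using F insert by (simp add: card_insert_if)
    ultimately show ?thesis
      using F(1) by (intro exI[of _ "insert g F"]) auto
  qed
qed

text \<open>
  For an orthonormal basis \<open>F\<close> of the approximating subspace, the energies
  \<open>\<Sum>f\<in>F. \<bar>ip e f\<bar>\<^sup>2\<close> of the vectors \<open>e \<in> E\<close> add up to at most \<open>card F \<le> card E / 2\<close>,
  so one of them is at most \<open>1/2\<close>.
\<close>

lemma kolmogorov_width_ge_orthonormal:
  assumes A: "A \<subseteq> vecs X" "\<And>a. a \<in> A \<Longrightarrow> nrm X a \<le> M"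
    and E: "finite E" "orthonormal E" "2 * n \<le> card E" "E \<noteq> {}"
    and c: "\<And>e. e \<in> E \<Longrightarrow> \<exists>c. \<tau> \<le> cmod c \<and> scl X c e \<in> A"
    and \<tau>: "0 \<le> \<tau>"
  shows "\<tau> / sqrt 2 \<le> kolmogorov_width X A n"
proof (rule kolmogorov_width_ge[OF A])
  fix B assume "finite B" "B \<subseteq> vecs X" "card B \<le> n"
  then obtain F where F: "finite F" "card F \<le> n" "orthonormal F" "span B \<subseteq> span F"
    using ex_orthonormal_spanning[of B] by auto
  have FX: "F \<subseteq> vecs X" and EX: "E \<subseteq> vecs X"
    using F E by (auto simp: orthonormal_def)
  define S where "S e = (\<Sum>f\<in>F. (cmod (ip e f))\<^sup>2)" for e
  have "(\<Sum>e\<in>E. S e) = (\<Sum>f\<in>F. \<Sum>e\<in>E. (cmod (ip e f))\<^sup>2)"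
    unfolding S_def by (rule sum.swap)
  also have "\<dots> = (\<Sum>f\<in>F. \<Sum>e\<in>E. (cmod (ip f e))\<^sup>2)"
    using FX EX by (intro sum.cong refl) (metis complex_mod_cnj ip_commute subsetD)
  also have "\<dots> \<le> (\<Sum>f\<in>F. 1)"
    using F(3) FX E by (intro sum_mono order_trans[OF bessel]) (auto simp: orthonormal_def)
  also have "\<dots> \<le> (\<Sum>e\<in>E. 1 / 2)"
    using F(2) E(3) by simp
  finally have "\<exists>e\<in>E. S e \<le> 1 / 2"
    using E(1,4) by (meson linorder_not_le sum_strict_mono)
  then obtain e where e: "e \<in> E" "S e \<le> 1 / 2"
    by blast
  then obtain c where c: "\<tau> \<le> cmod c" "scl X c e \<in> A"
    using assms(7) by blast
  have eX: "e \<in> vecs X" "nrm X e = 1"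
    using e E by (auto simp: orthonormal_def)
  \<comment> \<open>The span of \<open>F\<close> captures at most half of the squared norm of
    \<open>e\<close>, hence of its multiple by \<open>c\<close>. The other half remains as error,
    which explains the factor \<open>sqrt 2\<close>.\<close>
  have "\<tau> / sqrt 2 \<le> nrm X (scl X c e - v)" if "v \<in> span B" for v
  proof (rule power2_le_imp_le)
    have "(\<tau> / sqrt 2)\<^sup>2 \<le> (cmod c)\<^sup>2 * (1 / 2)"
      using c \<tau> by (simp add: power_divide power_mono)
    also have "\<dots> \<le> (cmod c)\<^sup>2 * (1 - S e)"
      using e by (intro mult_left_mono) auto
    also have "\<dots> = (nrm X (scl X c e))\<^sup>2 - (\<Sum>f\<in>F. (cmod (ip (scl X c e) f))\<^sup>2)"
    proof -
      have "(\<Sum>f\<in>F. (cmod (ip (scl X c e) f))\<^sup>2) = (cmod c)\<^sup>2 * S e"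
        unfolding S_def sum_distrib_left using eX FX
        by (intro sum.cong) (auto simp: ip_scl_left norm_mult power_mult_distrib)
      then show ?thesis
        using eX by (simp add: nrm_scl power_mult_distrib algebra_simps)
    qed
    also have "\<dots> \<le> (nrm X (scl X c e - v))\<^sup>2"
      using F eX that by (intro nrm_diff_span_orthonormal vecs_closed) auto
    finally show "(\<tau> / sqrt 2)\<^sup>2 \<le> (nrm X (scl X c e - v))\<^sup>2" .
    have "v \<in> vecs X"
      using that F(4) span_minimal[OF FX subspace_vecs] by auto
    then show "0 \<le> nrm X (scl X c e - v)"
      using eX by (intro nrm_nonneg vecs_closed)
  qed
  then show "\<exists>a\<in>A. \<forall>v\<in>span B. \<tau> / sqrt 2 \<le> nrm X (a - v)"
    using c by blast
qed

end

section \<open>Continuous bilinear maps\<close>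

text \<open>The constant may depend on the point \<open>a\<close> and is required only within
  distance 1 of it, because quadratic maps are in general not globally Lipschitz.\<close>

lemma continuous_map_locally_lipschitz:
  assumes "complex_normed_space X" "complex_normed_space Y"
    and "\<And>x. x \<in> vecs X \<Longrightarrow> f x \<in> vecs Y"
    and "\<And>a. a \<in> vecs X \<Longrightarrow> \<exists>C. \<forall>x\<in>vecs X. nrm X (a - x) \<le> 1 \<longrightarrow>
      nrm Y (f a - f x) \<le> C * nrm X (a - x)"
  shows "continuous_map (ctop X) (ctop Y) f"
proof -
  interpret X: complex_normed_space X by fact
  interpret Y: complex_normed_space Y by fact
  have "\<exists>\<delta>>0. \<forall>x. x \<in> vecs X \<and> cdist X a x < \<delta> \<longrightarrow> cdist Y (f a) (f x) < \<epsilon>"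
    if "a \<in> vecs X" "0 < \<epsilon>" for a \<epsilon>
  proof -
    obtain C where C: "\<And>x. x \<in> vecs X \<Longrightarrow> nrm X (a - x) \<le> 1 \<Longrightarrow>
        nrm Y (f a - f x) \<le> C * nrm X (a - x)"
      using assms(4) \<open>a \<in> vecs X\<close> by blast
    \<comment> \<open>The 1 keeps \<open>x\<close> in the region where the estimate holds;
      \<open>\<bar>C\<bar> + 1\<close> is a positive constant that dominates \<open>C\<close>
      whatever its sign.\<close>
    define \<delta> where "\<delta> = min 1 (\<epsilon> / (\<bar>C\<bar> + 1))"
    have "cdist Y (f a) (f x) < \<epsilon>" if x: "x \<in> vecs X" "cdist X a x < \<delta>" for x
    proof -
      have d: "0 \<le> nrm X (a - x)" "nrm X (a - x) < \<delta>"
        using x \<open>a \<in> vecs X\<close> by (auto simp: X.cdist_nrm intro!: X.nrm_nonneg X.vecs_closed)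
      then have "nrm Y (f a - f x) \<le> C * nrm X (a - x)"
        using C x by (auto simp: \<delta>_def)
      also have "\<dots> \<le> (\<bar>C\<bar> + 1) * nrm X (a - x)"
        using d by (intro mult_right_mono) auto
      also have "\<dots> < \<epsilon>"
        using d by (simp add: \<delta>_def pos_less_divide_eq mult.commute)
      finally show ?thesis
        using assms(3) x \<open>a \<in> vecs X\<close> by (simp add: Y.cdist_nrm)
    qed
    moreover have "0 < \<delta>"
      using \<open>0 < \<epsilon>\<close> by (simp add: \<delta>_def)
    ultimately show ?thesis
      by blast
  qed
  then show ?thesis
    unfolding ctop_def X.metric.metric_continuous_map[OF Y.Metric_space_cdist]
    using assms(3) by auto
qed

locale complex_bounded_bilinear =
  X: complex_normed_space X + Y: complex_normed_space Y
  for X :: "'a::ab_group_add cspace" and Y :: "'b::ab_group_add cspace" +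
  fixes B :: "'a \<Rightarrow> 'a \<Rightarrow> 'b"
  assumes closed: "x \<in> vecs X \<Longrightarrow> y \<in> vecs X \<Longrightarrow> B x y \<in> vecs Y"
    and add_left: "x \<in> vecs X \<Longrightarrow> y \<in> vecs X \<Longrightarrow> z \<in> vecs X \<Longrightarrow> B (x + y) z = B x z + B y z"
    and add_right: "x \<in> vecs X \<Longrightarrow> y \<in> vecs X \<Longrightarrow> z \<in> vecs X \<Longrightarrow> B x (y + z) = B x y + B x z"
    and scl_left: "x \<in> vecs X \<Longrightarrow> y \<in> vecs X \<Longrightarrow> B (scl X c x) y = scl Y c (B x y)"
    and scl_right: "x \<in> vecs X \<Longrightarrow> y \<in> vecs X \<Longrightarrow> B x (scl X c y) = scl Y c (B x y)"
    and bounded: "\<exists>C\<ge>0. \<forall>x\<in>vecs X. \<forall>y\<in>vecs X. nrm Y (B x y) \<le> C * (nrm X x * nrm X y)"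
begin

lemma diff_left: "x \<in> vecs X \<Longrightarrow> y \<in> vecs X \<Longrightarrow> z \<in> vecs X \<Longrightarrow> B (x - y) z = B x z - B y z"
  using add_left[of "x - y" y z] by (simp add: X.vecs_closed)

lemma diff_right: "x \<in> vecs X \<Longrightarrow> y \<in> vecs X \<Longrightarrow> z \<in> vecs X \<Longrightarrow> B x (y - z) = B x y - B x z"
  using add_right[of x "y - z" z] by (simp add: X.vecs_closed)

lemma continuous_hom_poly_diagonal: "continuous_hom_poly 2 X Y (\<lambda>x. B x x)"
  unfolding continuous_hom_poly_def
proof (intro conjI exI[of _ "\<lambda>xs. B (xs ! 0) (xs ! 1)"] ballI)
  obtain C where C: "C \<ge> 0" "\<And>x y. x \<in> vecs X \<Longrightarrow> y \<in> vecs X \<Longrightarrow> nrm Y (B x y) \<le> C * (nrm X x * nrm X y)"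
    using bounded by blast
  show "continuous_map (ctop X) (ctop Y) (\<lambda>x. B x x)"
  proof (rule continuous_map_locally_lipschitz)
    fix a assume a: "a \<in> vecs X"
    show "\<exists>C. \<forall>x\<in>vecs X. nrm X (a - x) \<le> 1 \<longrightarrow> nrm Y (B a a - B x x) \<le> C * nrm X (a - x)"
    \<comment> \<open>The constant comes from the splitting
      \<open>B a a - B x x = B a (a - x) + B (a - x) x\<close> together with
      \<open>nrm X x \<le> nrm X a + 1\<close>.\<close>
    proof (intro exI[of _ "C * (2 * nrm X a + 1)"] ballI impI)
      fix x assume x: "x \<in> vecs X" "nrm X (a - x) \<le> 1"
      have d: "a - x \<in> vecs X"
        using a x by (intro X.vecs_closed)
      have nx: "nrm X x \<le> nrm X a + 1"
      proof -
        have "nrm X x = nrm X (a + (x - a))"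
          by simp
        also have "\<dots> \<le> nrm X a + nrm X (x - a)"
          using a x by (intro X.nrm_triangle X.vecs_closed)
        finally show ?thesis
          using x a X.nrm_minus_commute[of x a] by simp
      qed
      have "nrm Y (B a a - B x x) = nrm Y (B a (a - x) + B (a - x) x)"
        using a x by (simp add: diff_left diff_right)
      also have "\<dots> \<le> nrm Y (B a (a - x)) + nrm Y (B (a - x) x)"
        using a x d by (intro Y.nrm_triangle closed)
      also have "\<dots> \<le> C * (nrm X a * nrm X (a - x)) + C * (nrm X (a - x) * nrm X x)"
        using a x d by (intro add_mono C)
      also have "\<dots> \<le> C * (nrm X a * nrm X (a - x)) + C * (nrm X (a - x) * (nrm X a + 1))"
        using C(1) X.nrm_nonneg[OF d] nx by (intro add_left_mono mult_left_mono)
      finally show "nrm Y (B a a - B x x) \<le> C * (2 * nrm X a + 1) * nrm X (a - x)"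
        by (simp add: algebra_simps)
    qed
  qed (auto intro: closed X.complex_normed_space_axioms Y.complex_normed_space_axioms)
  show "multilinear_on 2 X Y (\<lambda>xs. B (xs ! 0) (xs ! 1))"
    unfolding multilinear_on_def
  proof (intro allI impI conjI ballI, goal_cases)
    case (1 xs)
    then show ?case
      by (intro closed) (auto simp: subset_iff)
  next
    case (2 xs k x y)
    then have "k = 0 \<or> k = 1" "xs ! 0 \<in> vecs X" "xs ! 1 \<in> vecs X"
      by (auto simp: subset_iff)
    with 2 show ?case
      by (auto simp: add_left add_right)
  next
    case (3 xs k c x)
    then have "k = 0 \<or> k = 1" "xs ! 0 \<in> vecs X" "xs ! 1 \<in> vecs X"
      by (auto simp: subset_iff)
    with 3 show ?case
      by (auto simp: scl_left scl_right)
  qed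
qed (simp add: numeral_2_eq_2)

text \<open>This is the derivative at \<open>a\<close> of the diagonal map. Both orders of the
  arguments occur because \<open>B\<close> is not assumed symmetric.\<close>

lemma continuous_hom_poly_derivative:
  assumes a: "a \<in> vecs X"
  shows "continuous_hom_poly 1 X Y (\<lambda>h. B a h + B h a)"
  unfolding continuous_hom_poly_def
proof (intro conjI exI[of _ "\<lambda>xs. B a (xs ! 0) + B (xs ! 0) a"] ballI)
  obtain C where C: "C \<ge> 0" "\<And>x y. x \<in> vecs X \<Longrightarrow> y \<in> vecs X \<Longrightarrow> nrm Y (B x y) \<le> C * (nrm X x * nrm X y)"
    using bounded by blast
  show "continuous_map (ctop X) (ctop Y) (\<lambda>h. B a h + B h a)"
  proof (rule continuous_map_locally_lipschitz)
    fix x assume x: "x \<in> vecs X"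
    show "\<exists>C. \<forall>y\<in>vecs X. nrm X (x - y) \<le> 1 \<longrightarrow>
      nrm Y (B a x + B x a - (B a y + B y a)) \<le> C * nrm X (x - y)"
    proof (intro exI[of _ "2 * C * nrm X a"] ballI impI)
      fix y assume y: "y \<in> vecs X"
      then have d: "x - y \<in> vecs X"
        using x by (intro X.vecs_closed)
      have "nrm Y (B a x + B x a - (B a y + B y a)) = nrm Y (B a (x - y) + B (x - y) a)"
        using a x y by (simp add: diff_left diff_right algebra_simps)
      also have "\<dots> \<le> nrm Y (B a (x - y)) + nrm Y (B (x - y) a)"
        using a d by (intro Y.nrm_triangle closed)
      also have "\<dots> \<le> C * (nrm X a * nrm X (x - y)) + C * (nrm X (x - y) * nrm X a)"
        using a d by (intro add_mono C)
      finally show "nrm Y (B a x + B x a - (B a y + B y a)) \<le> 2 * C * nrm X a * nrm X (x - y)"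
        by (simp add: algebra_simps)
    qed
  qed (use a in \<open>auto intro: closed Y.vecs_closed
      X.complex_normed_space_axioms Y.complex_normed_space_axioms\<close>)
  show "multilinear_on 1 X Y (\<lambda>xs. B a (xs ! 0) + B (xs ! 0) a)"
    unfolding multilinear_on_def
    using a by (auto simp: length_Suc_conv add_left add_right scl_left scl_right
        Y.scale_right_distrib algebra_simps intro!: closed Y.vecs_closed)
qed simp

lemma continuous_hom_poly_zero: "continuous_hom_poly m X Y (\<lambda>_. 0)"
  unfolding continuous_hom_poly_def multilinear_on_def ctop_def
  by (auto intro!: exI[of _ "\<lambda>_. 0"] Y.vecs_closed)

text \<open>The expansion at \<open>a\<close> terminates: with \<open>h = x - a\<close>,
  \<open>B x x = B a a + (B a h + B h a) + B h h\<close>. Partial sums are exact from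
  \<open>N = 2\<close> on, so they converge uniformly on any ball inside \<open>U\<close>.\<close>

lemma holomorphic_map_diagonal:
  assumes U: "openin (ctop X) U"
  shows "holomorphic_map X Y U (\<lambda>x. B x x)"
  unfolding holomorphic_map_def
proof (intro conjI ballI)
  have UX: "U \<subseteq> vecs X"
    using openin_subset[OF U] by (simp add: ctop_def)
  then show "(\<lambda>x. B x x) ` U \<subseteq> vecs Y"
    by (auto intro: closed)
  fix a assume a: "a \<in> U"
  then have aX: "a \<in> vecs X"
    using UX by auto
  define P where "P m h = (if m = 1 then B a h + B h a else if m = 2 then B h h else 0)"
    for m :: nat and h
  obtain r where r: "r > 0" "X.metric.mball a r \<subseteq> U"
    using U a unfolding ctop_def X.metric.openin_mtopology by blast
  have P: "continuous_hom_poly m X Y (P m)" for m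
  proof -
    consider "m = 1" | "m = 2" | "m \<noteq> 1" "m \<noteq> 2"
      by blast
    then show ?thesis
      using continuous_hom_poly_diagonal continuous_hom_poly_derivative[OF aX]
        continuous_hom_poly_zero[of m]
      by cases (simp_all add: P_def[abs_def])
  qed
  have "B x x - (B a a + (\<Sum>m=1..N. P m (x - a))) = 0" if "x \<in> X.metric.mball a r" "2 \<le> N" for x N
  proof -
    have x: "x \<in> vecs X"
      using that by auto
    have "(\<Sum>m=1..N. P m (x - a)) = (\<Sum>m\<in>{1, 2}. P m (x - a))"
      using \<open>2 \<le> N\<close> by (intro sum.mono_neutral_right) (auto simp: P_def)
    then show ?thesis
      using x aX by (simp add: P_def diff_left diff_right X.vecs_closed algebra_simps)
  qed
  then have "\<forall>\<epsilon>>0. \<forall>\<^sub>F N in sequentially. \<forall>x\<in>X.metric.mball a r.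
      nrm Y (B x x - (B a a + (\<Sum>m=1..N. P m (x - a)))) < \<epsilon>"
    by (auto simp: eventually_sequentially Y.nrm_zero intro!: exI[of _ 2])
  with r P show "\<exists>r>0. \<exists>P. X.metric.mball a r \<subseteq> U \<and> (\<forall>m\<ge>1. continuous_hom_poly m X Y (P m)) \<and>
      (\<forall>\<epsilon>>0. \<forall>\<^sub>F N in sequentially. \<forall>x\<in>X.metric.mball a r.
         nrm Y (B x x - (B a a + (\<Sum>m=1..N. P m (x - a)))) < \<epsilon>)"
    by blast
qed (rule U)

end

section \<open>The space of square-summable sequences\<close>

definition l2 :: "(nat \<Rightarrow> complex) cspace" where
  "l2 = \<lparr>vecs = {x. summable (\<lambda>k. (cmod (x k))\<^sup>2)}, scl = (\<lambda>c x k. c * x k),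
     nrm = (\<lambda>x. sqrt (\<Sum>k. (cmod (x k))\<^sup>2))\<rparr>"

lemma mem_l2: "x \<in> vecs l2 \<longleftrightarrow> summable (\<lambda>k. (cmod (x k))\<^sup>2)"
  and scl_l2: "scl l2 c x = (\<lambda>k. c * x k)"
  and nrm_l2: "nrm l2 x = sqrt (\<Sum>k. (cmod (x k))\<^sup>2)"
  by (simp_all add: l2_def)

lemma nrm_l2_power2: "x \<in> vecs l2 \<Longrightarrow> (nrm l2 x)\<^sup>2 = (\<Sum>k. (cmod (x k))\<^sup>2)"
  by (simp add: nrm_l2 mem_l2 suminf_nonneg)

lemma nrm_l2_nonneg: "x \<in> vecs l2 \<Longrightarrow> 0 \<le> nrm l2 x"
  by (simp add: nrm_l2 mem_l2 suminf_nonneg)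

lemma sum_le_nrm_l2:
  "x \<in> vecs l2 \<Longrightarrow> finite F \<Longrightarrow> (\<Sum>k\<in>F. (cmod (x k))\<^sup>2) \<le> (nrm l2 x)\<^sup>2"
  by (simp add: nrm_l2_power2 mem_l2 sum_le_suminf)

lemma cmod_le_nrm_l2: "x \<in> vecs l2 \<Longrightarrow> cmod (x k) \<le> nrm l2 x"
  using sum_le_nrm_l2[of x "{k}"] nrm_l2_nonneg by (auto intro: power2_le_imp_le)

lemma L2_set_le_nrm_l2: "x \<in> vecs l2 \<Longrightarrow> L2_set (\<lambda>k. cmod (x k)) {..<n} \<le> nrm l2 x"
  using sum_le_nrm_l2[of x "{..<n}"] nrm_l2_nonneg by (simp add: L2_set_def real_le_lsqrt sum_nonneg)

text \<open>Together with \<open>L2_set_le_nrm_l2\<close>, this reduces membership and norm bounds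
  to Euclidean norms of finite sections. The triangle inequality, completeness and the tensor bound
  are all obtained this way.\<close>

lemma l2I:
  assumes "\<And>n. L2_set (\<lambda>k. cmod (x k)) {..<n} \<le> C"
  shows "x \<in> vecs l2" and "nrm l2 x \<le> C"
proof -
  \<comment> \<open>The empty section has norm 0.\<close>
  have "0 \<le> C"
    using assms[of 0] by simp
  have *: "(\<Sum>k<n. (cmod (x k))\<^sup>2) \<le> C\<^sup>2" for n
    using assms[of n] by (simp add: L2_set_def sqrt_le_D)
  then show "x \<in> vecs l2"
    unfolding mem_l2 by (intro summableI_nonneg_bounded[of _ "C\<^sup>2"]) auto
  then have "(\<Sum>k. (cmod (x k))\<^sup>2) \<le> C\<^sup>2"
    using * by (intro suminf_le_const) (auto simp: mem_l2)
  then show "nrm l2 x \<le> C"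
    using \<open>0 \<le> C\<close> by (simp add: nrm_l2 real_le_lsqrt)
qed

lemma l2_add:
  assumes "x \<in> vecs l2" "y \<in> vecs l2"
  shows "x + y \<in> vecs l2" and "nrm l2 (x + y) \<le> nrm l2 x + nrm l2 y"
proof -
  have *: "L2_set (\<lambda>k. cmod ((x + y) k)) {..<n} \<le> nrm l2 x + nrm l2 y" for n
  proof -
    have "L2_set (\<lambda>k. cmod ((x + y) k)) {..<n} \<le> L2_set (\<lambda>k. cmod (x k) + cmod (y k)) {..<n}"
      by (intro L2_set_mono) (auto intro: norm_triangle_ineq)
    also have "\<dots> \<le> L2_set (\<lambda>k. cmod (x k)) {..<n} + L2_set (\<lambda>k. cmod (y k)) {..<n}"
      by (rule L2_set_triangle_ineq)
    also have "\<dots> \<le> nrm l2 x + nrm l2 y"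
      using assms by (intro add_mono L2_set_le_nrm_l2)
    finally show ?thesis .
  qed
  show "x + y \<in> vecs l2"
    by (rule l2I(1)) (rule *)
  show "nrm l2 (x + y) \<le> nrm l2 x + nrm l2 y"
    by (rule l2I(2)) (rule *)
qed

lemma l2_scl:
  assumes "x \<in> vecs l2"
  shows "scl l2 c x \<in> vecs l2" and "nrm l2 (scl l2 c x) = cmod c * nrm l2 x"
proof -
  have *: "(cmod (scl l2 c x k))\<^sup>2 = (cmod c)\<^sup>2 * (cmod (x k))\<^sup>2" for k
    by (simp add: scl_l2 norm_mult power_mult_distrib)
  show "scl l2 c x \<in> vecs l2"
    using assms unfolding mem_l2 * by (rule summable_mult)
  show "nrm l2 (scl l2 c x) = cmod c * nrm l2 x"
    using assms unfolding nrm_l2 * by (subst suminf_mult) (auto simp: mem_l2 real_sqrt_mult)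
qed

lemma complex_normed_space_l2: "complex_normed_space l2"
proof -
  interpret vector_space "scl l2"
    by unfold_locales (auto simp: scl_l2 fun_eq_iff algebra_simps)
  show ?thesis
  proof
    show "subspace (vecs l2)"
      using l2_add l2_scl by (auto simp: subspace_def mem_l2[of 0])
    show "nrm l2 x = 0 \<longleftrightarrow> x = 0" if "x \<in> vecs l2" for x
    proof
      assume "nrm l2 x = 0"
      then show "x = 0"
        using cmod_le_nrm_l2[OF that] by (auto simp: fun_eq_iff)
    qed (simp add: nrm_l2)
  qed (auto intro: l2_add l2_scl)
qed

interpretation l2: complex_normed_space l2
  by (rule complex_normed_space_l2)

section \<open>Inner product, completeness and separability of the sequence space\<close>

definition l2_ip :: "(nat \<Rightarrow> complex) \<Rightarrow> (nat \<Rightarrow> complex) \<Rightarrow> complex" where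
  "l2_ip x y = (\<Sum>k. x k * cnj (y k))"

text \<open>Dominated by a sum of squares, since \<open>2 * a * b \<le> a^2 + b^2\<close>.\<close>

lemma summable_l2_ip:
  assumes "x \<in> vecs l2" "y \<in> vecs l2"
  shows "summable (\<lambda>k. x k * cnj (y k))"
proof (rule summable_comparison_test')
  show "summable (\<lambda>k. (cmod (x k))\<^sup>2 + (cmod (y k))\<^sup>2)"
    using assms by (auto simp: mem_l2 intro: summable_add)
  show "norm (x k * cnj (y k)) \<le> (cmod (x k))\<^sup>2 + (cmod (y k))\<^sup>2" for k
    using sum_squares_bound[of "cmod (x k)" "cmod (y k)"]
      mult_nonneg_nonneg[OF norm_ge_zero[of "x k"] norm_ge_zero[of "y k"]]
    unfolding norm_mult complex_mod_cnj by linarith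
qed

lemma inner_product_of_l2: "inner_product_of l2 l2_ip"
  unfolding inner_product_of_def
proof (intro conjI ballI allI)
  fix x y z :: "nat \<Rightarrow> complex" and c
  assume x: "x \<in> vecs l2" and y: "y \<in> vecs l2"
  show "l2_ip y x = cnj (l2_ip x y)"
    using bounded_linear.suminf[OF bounded_linear_cnj summable_l2_ip[OF x y]]
    by (simp add: l2_ip_def mult.commute)
  show "l2_ip (scl l2 c x) y = c * l2_ip x y"
    using suminf_mult[OF summable_l2_ip[OF x y], of c] by (simp add: l2_ip_def scl_l2 mult.assoc)
  assume z: "z \<in> vecs l2"
  show "l2_ip (x + y) z = l2_ip x z + l2_ip y z"
    using suminf_add[OF summable_l2_ip[OF x z] summable_l2_ip[OF y z]]
    by (simp add: l2_ip_def algebra_simps)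
next
  fix x assume x: "x \<in> vecs l2"
  have "l2_ip x x = (\<Sum>k. of_real ((cmod (x k))\<^sup>2))"
    by (simp add: l2_ip_def complex_norm_square[symmetric])
  also have "\<dots> = of_real (\<Sum>k. (cmod (x k))\<^sup>2)"
    using x by (intro suminf_of_real[symmetric]) (simp add: mem_l2)
  finally show "l2_ip x x = of_real ((nrm l2 x)\<^sup>2)"
    using x by (simp add: nrm_l2_power2)
qed

text \<open>Each coordinate of a Cauchy sequence is Cauchy; the sequence \<open>L\<close> of
  coordinate limits is then shown to be the limit in norm.\<close>

lemma mcomplete_l2: "l2.metric.mcomplete"
  unfolding l2.metric.mcomplete_def
proof (intro allI impI)
  fix x assume "l2.metric.MCauchy x"
  then have xl2: "x n \<in> vecs l2" and
    C: "\<And>\<epsilon>. \<epsilon> > 0 \<Longrightarrow> \<exists>N. \<forall>m n. N \<le> m \<longrightarrow> N \<le> n \<longrightarrow> nrm l2 (x m - x n) < \<epsilon>" for n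
    unfolding l2.metric.MCauchy_def by (auto simp: l2.cdist_nrm image_subset_iff)
  have "Cauchy (\<lambda>n. x n k)" for k
  proof (rule CauchyI)
    fix \<epsilon> :: real assume "\<epsilon> > 0"
    then obtain N where "\<And>m n. N \<le> m \<Longrightarrow> N \<le> n \<Longrightarrow> nrm l2 (x m - x n) < \<epsilon>"
      using C by blast
    moreover have "cmod (x m k - x n k) \<le> nrm l2 (x m - x n)" for m n
      using cmod_le_nrm_l2[of "x m - x n" k] xl2 by (simp add: l2.vecs_closed)
    ultimately show "\<exists>N. \<forall>m\<ge>N. \<forall>n\<ge>N. norm (x m k - x n k) < \<epsilon>"
      by (meson order_le_less_trans)
  qed
  then have "\<forall>k. \<exists>l. (\<lambda>n. x n k) \<longlonglongrightarrow> l"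
    by (simp add: Cauchy_convergent_iff convergent_def)
  then obtain L where L: "\<And>k. (\<lambda>n. x n k) \<longlonglongrightarrow> L k"
    by metis
  have tail: "\<exists>N. \<forall>n\<ge>N. x n - L \<in> vecs l2 \<and> nrm l2 (x n - L) \<le> \<epsilon>" if "\<epsilon> > 0" for \<epsilon>
  proof -
    obtain N where N: "\<And>m n. N \<le> m \<Longrightarrow> N \<le> n \<Longrightarrow> nrm l2 (x n - x m) < \<epsilon>"
      using C[OF \<open>\<epsilon> > 0\<close>] by blast
    \<comment> \<open>Only finitely many coordinates are involved, so \<open>m\<close> may tend to
      infinity in the Cauchy estimate. The bound does not depend on \<open>K\<close>, and
      \<open>l2I\<close> extends it to the whole sequence.\<close>
    have "L2_set (\<lambda>k. cmod ((x n - L) k)) {..<K} \<le> \<epsilon>" if "N \<le> n" for n K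
    proof (rule tendsto_upperbound)
      show "(\<lambda>m. L2_set (\<lambda>k. cmod ((x n - x m) k)) {..<K})
          \<longlonglongrightarrow> L2_set (\<lambda>k. cmod ((x n - L) k)) {..<K}"
        unfolding L2_set_def fun_diff_def by (intro tendsto_intros L)
      show "\<forall>\<^sub>F m in sequentially. L2_set (\<lambda>k. cmod ((x n - x m) k)) {..<K} \<le> \<epsilon>"
        using eventually_ge_at_top[of N]
      proof eventually_elim
        case (elim m)
        have "L2_set (\<lambda>k. cmod ((x n - x m) k)) {..<K} \<le> nrm l2 (x n - x m)"
          using xl2 by (intro L2_set_le_nrm_l2 l2.vecs_closed)
        then show ?case
          using N[OF elim \<open>N \<le> n\<close>] by simp
      qed
    qed simp
    then show ?thesis
      by (intro exI[of _ N] allI impI conjI l2I)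
  qed
  obtain N where N: "x N - L \<in> vecs l2"
    using tail[of 1] by auto
  \<comment> \<open>Here \<open>L = x N - (x N - L)\<close>.\<close>
  have Ll2: "L \<in> vecs l2"
    using l2.vecs_closed(3)[OF xl2[of N] N] by simp
  have "(\<lambda>n. nrm l2 (x n - L)) \<longlonglongrightarrow> 0"
  proof (rule LIMSEQ_I)
    fix r :: real assume "r > 0"
    then obtain N where N: "\<And>n. n \<ge> N \<Longrightarrow> x n - L \<in> vecs l2 \<and> nrm l2 (x n - L) \<le> r / 2"
      using tail[of "r / 2"] by auto
    have "norm (nrm l2 (x n - L) - 0) < r" if "n \<ge> N" for n
      using \<open>r > 0\<close> N[OF that] nrm_l2_nonneg[of "x n - L"] by simp
    then show "\<exists>N. \<forall>n\<ge>N. norm (nrm l2 (x n - L) - 0) < r"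
      by blast
  qed
  then show "\<exists>l. limitin l2.metric.mtopology x l sequentially"
    using Ll2 xl2 l2.limitin_ctop_iff[of x L] by (auto simp: ctop_def image_subset_iff)
qed

lemma complex_hilbert_space_l2: "complex_hilbert_space l2"
  by unfold_locales (use mcomplete_l2 inner_product_of_l2 in auto)

lemma rational_complex_dense:
  fixes z :: complex
  assumes "\<epsilon> > 0"
  shows "\<exists>p q. cmod (z - Complex (of_rat p) (of_rat q)) < \<epsilon>"
proof -
  obtain p where p: "Re z < of_rat p" "of_rat p < Re z + \<epsilon> / 2"
    using of_rat_dense[of "Re z" "Re z + \<epsilon> / 2"] assms by auto
  obtain q where q: "Im z < of_rat q" "of_rat q < Im z + \<epsilon> / 2"
    using of_rat_dense[of "Im z" "Im z + \<epsilon> / 2"] assms by auto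
  have "cmod (z - Complex (of_rat p) (of_rat q)) \<le> \<bar>Re z - of_rat p\<bar> + \<bar>Im z - of_rat q\<bar>"
    using cmod_le[of "z - Complex (of_rat p) (of_rat q)"] by simp
  also have "\<dots> < \<epsilon>"
    using p q by simp
  finally show ?thesis
    by blast
qed

lemma separable_l2: "separable l2"
proof -
  \<comment> \<open>The dense set consists of the finitely supported sequences with rational real
    and imaginary parts. Indexing them by lists over a countable type makes countability
    immediate.\<close>
  define seq where "seq ps = (\<lambda>k. if k < length ps
      then Complex (of_rat (fst (ps ! k))) (of_rat (snd (ps ! k))) else 0)" for ps :: "(rat \<times> rat) list"
  have seq: "seq ps \<in> vecs l2" for ps
    unfolding mem_l2 by (rule summable_finite[of "{..<length ps}"]) (auto simp: seq_def)
  have "\<exists>y\<in>range seq. y \<in> l2.metric.mball x r" if x: "x \<in> vecs l2" and r: "r > 0" for x r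
  proof -
    obtain n where n: "\<And>m. m \<ge> n \<Longrightarrow> norm (\<Sum>k. (cmod (x (k + m)))\<^sup>2) < r\<^sup>2 / 2"
      using suminf_exist_split[of "r\<^sup>2 / 2" "\<lambda>k. (cmod (x k))\<^sup>2"] x r by (auto simp: mem_l2)
    from n[of n] have n: "(\<Sum>k. (cmod (x (k + n)))\<^sup>2) < r\<^sup>2 / 2"
      by (simp add: abs_less_iff)
    \<comment> \<open>The first \<open>n\<close> coordinates contribute at most
      \<open>n * \<epsilon>^2 \<le> r^2 / 2\<close>, and the tail contributes less than
      \<open>r^2 / 2\<close>. The added 1 keeps the denominator positive for
      \<open>n = 0\<close>.\<close>
    define \<epsilon> where "\<epsilon> = r / sqrt (2 * (real n + 1))"
    have \<epsilon>: "\<epsilon> > 0"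
      using r by (simp add: \<epsilon>_def)
    have "\<forall>k. \<exists>p. cmod (x k - Complex (of_rat (fst p)) (of_rat (snd p))) < \<epsilon>"
      using rational_complex_dense[OF \<epsilon>] by simp
    then obtain p where p: "\<And>k. cmod (x k - Complex (of_rat (fst (p k))) (of_rat (snd (p k)))) < \<epsilon>"
      by metis
    define y where "y = seq (map p [0..<n])"
    have d: "x - y \<in> vecs l2"
      unfolding y_def using x seq by (intro l2.vecs_closed)
    have "(\<Sum>k<n. (cmod ((x - y) k))\<^sup>2) \<le> (\<Sum>k<n. \<epsilon>\<^sup>2)"
      using p by (intro sum_mono power_mono) (auto simp: y_def seq_def less_imp_le)
    also have "\<dots> \<le> r\<^sup>2 / 2"
      using r by (simp add: \<epsilon>_def power_divide field_simps)
    finally have "(\<Sum>k. (cmod ((x - y) k))\<^sup>2) < r\<^sup>2"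
      using suminf_split_initial_segment[of "\<lambda>k. (cmod ((x - y) k))\<^sup>2" n] d n
      by (simp add: mem_l2 y_def seq_def)
    then have "nrm l2 (x - y) < r"
      using r by (simp add: nrm_l2 real_less_lsqrt)
    then show ?thesis
      using x seq by (intro bexI[of _ y]) (auto simp: y_def l2.cdist_nrm)
  qed
  then have "l2.metric.mtopology closure_of (range seq) = vecs l2"
    by (auto simp: l2.metric.metric_closure_of)
  then show ?thesis
    using seq unfolding separable_def separable_space_def ctop_def
    by (intro exI[of _ "range seq"]) auto
qed

section \<open>Coordinate vectors and the tensor map\<close>

definition l2_unit :: "nat \<Rightarrow> nat \<Rightarrow> complex" where
  "l2_unit k = (\<lambda>j. if j = k then 1 else 0)"

lemma l2_unit: "l2_unit k \<in> vecs l2" "nrm l2 (l2_unit k) = 1"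
proof -
  have *: "(\<lambda>j. (cmod (l2_unit k j))\<^sup>2) = (\<lambda>j. if j = k then 1 else 0)"
    by (auto simp: l2_unit_def)
  show "l2_unit k \<in> vecs l2"
    unfolding mem_l2 * by (rule summable_single)
  show "nrm l2 (l2_unit k) = 1"
    unfolding nrm_l2 * using suminf_finite[of "{k}" "\<lambda>j. if j = k then 1 else (0::real)"] by simp
qed

lemma inj_l2_unit: "inj l2_unit"
proof (rule injI)
  fix i j assume "l2_unit i = l2_unit j"
  from fun_cong[OF this, of i] show "i = j"
    by (simp add: l2_unit_def split: if_splits)
qed

interpretation l2: complex_inner_space l2 l2_ip
  by unfold_locales (rule inner_product_of_l2)

lemma orthonormal_l2_unit: "l2.orthonormal (l2_unit ` F)"
proof -
  have "l2_ip (l2_unit i) (l2_unit j) = 0" if "l2_unit i \<noteq> l2_unit j" for i j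
  proof -
    have "(\<lambda>k. l2_unit i k * cnj (l2_unit j k)) = (\<lambda>k. 0)"
      using that by (auto simp: l2_unit_def)
    then show ?thesis
      by (simp add: l2_ip_def)
  qed
  then show ?thesis
    by (auto simp: l2.orthonormal_def l2_unit)
qed

text \<open>A multiple of a coordinate vector inside \<open>F\<close> is its own approximant; any
  other one is approximated by 0.\<close>

lemma l2_span_units_approx:
  assumes "k \<in> F \<or> cmod c \<le> \<delta>" "0 \<le> \<delta>"
  shows "\<exists>v\<in>l2.span (l2_unit ` F). nrm l2 (scl l2 c (l2_unit k) - v) \<le> \<delta>"
proof (cases "k \<in> F")
  case True
  then have "scl l2 c (l2_unit k) \<in> l2.span (l2_unit ` F)"
    by (intro l2.span_scale l2.span_base imageI)
  then show ?thesis
    using assms by (intro bexI) (auto simp: l2.nrm_zero)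
next
  case False
  then show ?thesis
    using assms l2_unit by (intro bexI[of _ 0] l2.span_zero) (auto simp: l2_scl)
qed

text \<open>
  Taking the two factors from disjoint sets of coordinates keeps squares of coordinates out of the
  diagonal \<open>x \<mapsto> l2_tensor x x\<close>.
\<close>

definition l2_tensor :: "(nat \<Rightarrow> complex) \<Rightarrow> (nat \<Rightarrow> complex) \<Rightarrow> nat \<Rightarrow> complex" where
  "l2_tensor x y = (\<lambda>k. case prod_decode k of (i, j) \<Rightarrow> x (2 * i) * y (2 * j + 1))"

text \<open>Pairs with code below \<open>n\<close> have both entries below \<open>n\<close>, so a
  finite section is dominated by a square of indices, over which the sum factors. Its factors are
  sums over distinct even coordinates of \<open>x\<close> and distinct odd coordinates of
  \<open>y\<close>.\<close>

lemma l2_tensor: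
  assumes x: "x \<in> vecs l2" and y: "y \<in> vecs l2"
  shows "l2_tensor x y \<in> vecs l2" and "nrm l2 (l2_tensor x y) \<le> nrm l2 x * nrm l2 y"
proof -
  have "L2_set (\<lambda>k. cmod (l2_tensor x y k)) {..<n} \<le> nrm l2 x * nrm l2 y" for n
  proof -
    define f where "f = (\<lambda>(i, j). (cmod (x (2 * i)))\<^sup>2 * (cmod (y (2 * j + 1)))\<^sup>2)"
    have inj: "inj_on prod_decode {..<n}"
      by (rule inj_prod_decode)
    have "prod_decode ` {..<n} \<subseteq> {..<n} \<times> {..<n}"
    proof clarify
      fix k i j assume k: "k < n" "(i, j) = prod_decode k"
      then have "k = prod_encode (i, j)"
        by simp
      then show "i \<in> {..<n} \<and> j \<in> {..<n}"
        using le_prod_encode_1[of i j] le_prod_encode_2[of j i] k by auto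
    qed
    then have sub: "sum f (prod_decode ` {..<n}) \<le> sum f ({..<n} \<times> {..<n})"
      by (intro sum_mono2) (auto simp: f_def)
    have "(\<Sum>k<n. (cmod (l2_tensor x y k))\<^sup>2) = (\<Sum>k<n. f (prod_decode k))"
      by (intro sum.cong)
        (auto simp: l2_tensor_def f_def norm_mult power_mult_distrib split: prod.split)
    also have "\<dots> = sum f (prod_decode ` {..<n})"
      by (simp add: sum.reindex[OF inj])
    also have "\<dots> \<le> sum f ({..<n} \<times> {..<n})"
      by (rule sub)
    also have "\<dots> = (\<Sum>i<n. (cmod (x (2 * i)))\<^sup>2) * (\<Sum>j<n. (cmod (y (2 * j + 1)))\<^sup>2)"
      by (simp add: f_def sum.cartesian_product[symmetric] sum_product)
    also have "\<dots> = (\<Sum>i\<in>(\<lambda>i. 2 * i) ` {..<n}. (cmod (x i))\<^sup>2)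
        * (\<Sum>j\<in>(\<lambda>j. 2 * j + 1) ` {..<n}. (cmod (y j))\<^sup>2)"
      by (simp add: sum.reindex inj_on_def)
    also have "\<dots> \<le> (nrm l2 x)\<^sup>2 * (nrm l2 y)\<^sup>2"
      using x y by (intro mult_mono sum_le_nrm_l2 sum_nonneg) auto
    finally show ?thesis
      unfolding L2_set_def using x y
      by (intro real_le_lsqrt) (simp_all add: nrm_l2_nonneg power_mult_distrib)
  qed
  from l2I[of "l2_tensor x y", OF this]
  show "l2_tensor x y \<in> vecs l2" "nrm l2 (l2_tensor x y) \<le> nrm l2 x * nrm l2 y"
    by auto
qed

interpretation l2_tensor: complex_bounded_bilinear l2 l2 l2_tensor
proof
  show "\<exists>C\<ge>0. \<forall>x\<in>vecs l2. \<forall>y\<in>vecs l2. nrm l2 (l2_tensor x y) \<le> C * (nrm l2 x * nrm l2 y)"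
    using l2_tensor by (intro exI[of _ 1]) auto
  show "l2_tensor x y \<in> vecs l2" if "x \<in> vecs l2" "y \<in> vecs l2" for x y
    using that by (rule l2_tensor)
  show "l2_tensor (x + y) z = l2_tensor x z + l2_tensor y z" for x y z
    by (auto simp: l2_tensor_def fun_eq_iff distrib_right split: prod.split)
  show "l2_tensor x (y + z) = l2_tensor x y + l2_tensor x z" for x y z
    by (auto simp: l2_tensor_def fun_eq_iff distrib_left split: prod.split)
  show "l2_tensor (scl l2 c x) y = scl l2 c (l2_tensor x y)" for c x y
    by (auto simp: l2_tensor_def scl_l2 fun_eq_iff split: prod.split)
  show "l2_tensor x (scl l2 c y) = scl l2 c (l2_tensor x y)" for c x y
    by (auto simp: l2_tensor_def scl_l2 fun_eq_iff split: prod.split)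
qed

section \<open>Counting in the hyperbolic cross\<close>

text \<open>Slicing by \<open>i\<close> exhibits the cardinality as a sum of integer quotients;
  \<open>mem_hyperbolic_cross\<close> recovers the symmetric description by the product.\<close>

definition hyperbolic_cross :: "nat \<Rightarrow> (nat \<times> nat) set" where
  "hyperbolic_cross N = (SIGMA i:{1..N}. {1..N div i})"

lemma mem_hyperbolic_cross: "(i, j) \<in> hyperbolic_cross N \<longleftrightarrow> 1 \<le> i * j \<and> i * j \<le> N"
proof -
  have "i \<le> N \<and> j \<le> N div i \<longleftrightarrow> i * j \<le> N" if "0 < i" "0 < j"
    using that by (metis div_le_dividend less_eq_div_iff_mult_less_eq mult.commute mult_le_mono2
        nat_mult_1_right order.trans Suc_leI One_nat_def)
  then show ?thesis
    by (auto simp: hyperbolic_cross_def Suc_le_eq)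
qed

lemma finite_hyperbolic_cross: "finite (hyperbolic_cross N)"
  by (simp add: hyperbolic_cross_def)

lemma card_hyperbolic_cross: "card (hyperbolic_cross N) = (\<Sum>i=1..N. N div i)"
  by (simp add: hyperbolic_cross_def)

text \<open>Drop the rounding in \<open>N div i\<close> and use that \<open>harm N - ln N\<close> is
  decreasing, hence at most its value 1 at \<open>N = 1\<close>.\<close>

lemma card_hyperbolic_cross_le: "real (card (hyperbolic_cross N)) \<le> N * (1 + ln N)"
proof (cases "N = 0")
  case False
  have "real (card (hyperbolic_cross N)) \<le> (\<Sum>i=1..N. N * inverse (real i))"
    unfolding card_hyperbolic_cross of_nat_sum
    by (intro sum_mono) (simp add: divide_inverse[symmetric] of_nat_div_le_of_nat)
  also have "\<dots> = N * harm N"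
    by (simp add: harm_def sum_distrib_left)
  also have "\<dots> \<le> N * (1 + ln N)"
    using euler_mascheroni_sequence_decreasing[of 1 N] False
    by (intro mult_left_mono) (auto simp: harm_def)
  finally show ?thesis .
qed (simp add: card_hyperbolic_cross)

text \<open>For \<open>i \<le> N\<close> the quotient is at least 1, so rounding down loses at most
  half of it. The harmonic number then supplies the logarithm.\<close>

lemma card_hyperbolic_cross_ge: "N * ln (real N + 1) / 2 \<le> real (card (hyperbolic_cross N))"
proof -
  have *: "real N * inverse (real i) / 2 \<le> real (N div i)" if "i \<in> {1..N}" for i
  proof -
    have "1 \<le> N div i"
      using that by (simp add: Suc_le_eq div_greater_zero_iff)
    then have "i \<le> N div i * i"
      using mult_le_mono1[of 1 "N div i" i] by simp
    moreover have "N < i + N div i * i"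
      using that by (intro dividend_less_div_times) simp
    ultimately have "N \<le> 2 * (N div i * i)"
      by linarith
    then have "real N \<le> real (2 * (N div i * i))"
      by (rule of_nat_mono)
    then show ?thesis
      using that by (simp add: field_simps)
  qed
  have "N * ln (real N + 1) / 2 \<le> N * harm N / 2"
    using ln_le_harm[of N] by (intro divide_right_mono mult_left_mono) (auto simp: add.commute)
  also have "\<dots> = (\<Sum>i=1..N. real N * inverse (real i) / 2)"
    by (simp add: harm_def sum_distrib_left sum_divide_distrib)
  also have "\<dots> \<le> real (card (hyperbolic_cross N))"
    unfolding card_hyperbolic_cross of_nat_sum by (intro sum_mono *)
  finally show ?thesis .
qed

lemma ln_Suc_ge_half:
  assumes "1 \<le> n"
  shows "1 / 2 \<le> ln (real n + 1)"
proof -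
  have "ln 2 \<le> ln (real n + 1)"
    using assms by (subst ln_le_cancel_iff) auto
  then show ?thesis
    using ln2_ge_two_thirds by linarith
qed

text \<open>With \<open>L = ln (n + 1) \<ge> 1/2\<close>, the hypothesis forces
  \<open>N \<le> n\<close> and thus \<open>ln N \<le> L\<close>; the factor 3 arises from
  \<open>1 + ln N \<le> 2 * L + L\<close>.\<close>

lemma card_hyperbolic_cross_le_n:
  assumes n: "1 \<le> n" and N: "real N \<le> n / (3 * ln (real n + 1))"
  shows "card (hyperbolic_cross N) \<le> n"
proof (cases "N = 0")
  case False
  define L where "L = ln (real n + 1)"
  have L: "1 / 2 \<le> L"
    unfolding L_def by (rule ln_Suc_ge_half[OF n])
  have NL: "real N * (3 * L) \<le> n"
    using N L by (simp add: L_def[symmetric] pos_le_divide_eq)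
  have "real N * 1 \<le> real N * (3 * L)"
    using L by (intro mult_left_mono) auto
  then have "real N \<le> real n + 1"
    using NL by linarith
  then have "ln (real N) \<le> L"
    using False unfolding L_def by (subst ln_le_cancel_iff) auto
  have "real (card (hyperbolic_cross N)) \<le> N * (1 + ln N)"
    by (rule card_hyperbolic_cross_le)
  also have "\<dots> \<le> N * (3 * L)"
    using L \<open>ln (real N) \<le> L\<close> by (intro mult_left_mono) auto
  also have "\<dots> \<le> n"
    by (rule NL)
  finally show ?thesis
    by simp
qed (simp add: card_hyperbolic_cross)

lemma card_hyperbolic_cross_ge_2n:
  assumes n: "1 \<le> n" and N: "8 * n / ln (real n + 1) \<le> real N"
  shows "2 * n \<le> card (hyperbolic_cross N)"
proof -
  define L where "L = ln (real n + 1)"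
  have L: "1 / 2 \<le> L"
    unfolding L_def by (rule ln_Suc_ge_half[OF n])
  \<comment> \<open>The lower count involves \<open>ln (N + 1)\<close>, which must be compared with
    \<open>L\<close>. Since \<open>N\<close> is at least \<open>t\<close>, this logarithm is at
    least \<open>ln t = L / 2\<close>, and the count is at least
    \<open>N * L / 4 \<ge> 2 * n\<close>.\<close>
  define t where "t = sqrt (real n + 1)"
  have t: "t > 0" "t * t = real n + 1"
    by (simp_all add: t_def)
  have Lt: "L = 2 * ln t"
    by (simp add: L_def t_def ln_sqrt)
  have "ln t \<le> t"
    using t ln_le_minus_one[of t] by simp
  have "t * L \<le> 2 * (t * t)"
    using mult_left_mono[OF \<open>ln t \<le> t\<close>, of t] t(1) by (simp add: Lt)
  also have "\<dots> \<le> 8 * real n"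
    using t n by simp
  also have "\<dots> \<le> real N * L"
    using N L by (simp add: L_def[symmetric] pos_divide_le_eq)
  finally have "t \<le> real N"
    using L by simp
  then have "ln t \<le> ln (real N + 1)"
    using t by simp
  have "8 * n / 4 \<le> real N * L / 4"
    using N L by (intro divide_right_mono) (simp_all add: L_def[symmetric] pos_divide_le_eq)
  also have "\<dots> \<le> real N * ln (real N + 1) / 2"
    using mult_left_mono[OF \<open>ln t \<le> ln (real N + 1)\<close>, of "real N"] by (simp add: Lt)
  also have "\<dots> \<le> real (card (hyperbolic_cross N))"
    using card_hyperbolic_cross_ge[of N] by (simp add: add.commute)
  finally show ?thesis
    by simp
qed

section \<open>The compact set and its image\<close>

text \<open>The ordering of the two constants follows from the bounds at 1, where \<open>b\<close>
  is positive.\<close>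

lemma seq_comparableI:
  assumes "0 < c" "0 < b 1"
    and "\<And>n. 1 \<le> n \<Longrightarrow> c * b n \<le> a n" "\<And>n. 1 \<le> n \<Longrightarrow> a n \<le> C * b n"
  shows "seq_comparable a b"
proof -
  have "c * b 1 \<le> C * b 1"
    using assms(3,4)[of 1] by simp
  then show ?thesis
    using assms unfolding seq_comparable_def by (intro exI[of _ c] exI[of _ C]) auto
qed

text \<open>Since \<open>0 powr x = 0\<close>, the index \<open>0\<close> gives the zero vector.\<close>

definition weighted_unit :: "real \<Rightarrow> nat \<Rightarrow> nat \<Rightarrow> nat \<Rightarrow> complex" where
  "weighted_unit s i k = scl l2 (of_real (real i powr - s)) (l2_unit k)"

lemma weighted_unit: "weighted_unit s i k \<in> vecs l2" "nrm l2 (weighted_unit s i k) = real i powr - s"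
  by (simp_all add: weighted_unit_def l2_unit l2_scl)

lemma weighted_unit_0: "weighted_unit s 0 k = 0"
  by (simp add: weighted_unit_def)

lemma weight_le_1: "0 < s \<Longrightarrow> real i powr - s \<le> 1"
  by (cases "i = 0") (auto simp: powr_minus intro!: inverse_le_1_iff[THEN iffD2] ge_one_powr_ge_zero)

text \<open>From index \<open>t\<close> on, the weight is at most \<open>t powr - s\<close>, so 0 is
  a good enough approximant; smaller positive indices must have their coordinate in
  \<open>F\<close>.\<close>

lemma weighted_unit_approx:
  assumes "k \<in> F \<or> i = 0 \<or> t \<le> i" "0 < t" "0 < s"
  shows "\<exists>v\<in>l2.span (l2_unit ` F). nrm l2 (weighted_unit s i k - v) \<le> t powr - s"
  unfolding weighted_unit_def
proof (rule l2_span_units_approx)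
  show "k \<in> F \<or> cmod (of_real (real i powr - s)) \<le> t powr - s"
    using assms by (cases "i = 0") (auto intro!: powr_mono2')
qed simp

text \<open>A convergent sequence together with its limit is compact. The limit 0 is already the
  term of index 0.\<close>

lemma compactin_weighted_units:
  assumes "0 < s"
  shows "compactin (ctop l2) (range (\<lambda>i. weighted_unit s i (f i)))"
proof -
  let ?p = "\<lambda>i. weighted_unit s i (f i)"
  have "(\<lambda>i. real i powr - s) \<longlonglongrightarrow> 0"
    using assms by (intro tendsto_neg_powr filterlim_real_sequentially) simp
  then have "limitin (ctop l2) ?p (?p 0) sequentially"
    using weighted_unit by (subst l2.limitin_ctop_iff) (auto simp: weighted_unit_0 l2.vecs_closed)
  then have "compactin (ctop l2) (insert (?p 0) (range ?p))"
    using weighted_unit(1) by (intro compactin_sequence_with_limit) (auto simp: ctop_def)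
  then show ?thesis
    by (simp add: insert_absorb)
qed

definition two_term_set :: "real \<Rightarrow> (nat \<Rightarrow> complex) set" where
  "two_term_set s = {a + b |a b. a \<in> range (\<lambda>i. weighted_unit s i (2 * i)) \<and>
     b \<in> range (\<lambda>j. weighted_unit s j (2 * j + 1))}"

lemma two_term_setE:
  assumes "x \<in> two_term_set s"
  obtains i j where "x = weighted_unit s i (2 * i) + weighted_unit s j (2 * j + 1)"
  using assms by (auto simp: two_term_set_def)

lemma two_term_setI: "weighted_unit s i (2 * i) + weighted_unit s j (2 * j + 1) \<in> two_term_set s"
  by (auto simp: two_term_set_def)

lemma two_term_set_bounded:
  assumes "x \<in> two_term_set s" "0 < s"
  shows "x \<in> vecs l2" "nrm l2 x \<le> 2"
proof -
  obtain i j where x: "x = weighted_unit s i (2 * i) + weighted_unit s j (2 * j + 1)"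
    using assms two_term_setE by blast
  show "x \<in> vecs l2"
    unfolding x by (intro l2.vecs_closed weighted_unit)
  have "nrm l2 x \<le> real i powr - s + real j powr - s"
    unfolding x using l2_add(2)[OF weighted_unit(1) weighted_unit(1)] by (simp add: weighted_unit)
  then show "nrm l2 x \<le> 2"
    using weight_le_1[OF assms(2), of i] weight_le_1[OF assms(2), of j] by simp
qed

text \<open>By parity, even coordinates of \<open>x\<close> see only the first summand and odd ones
  only the second. A single product survives, and its weights multiply to that of
  \<open>i * j\<close>.\<close>

lemma l2_tensor_two_term:
  fixes i j :: nat and s :: real
  defines "x \<equiv> weighted_unit s i (2 * i) + weighted_unit s j (2 * j + 1)"
  shows "l2_tensor x x = weighted_unit s (i * j) (prod_encode (i, j))"
proof
  fix k
  obtain a b where ab: "prod_decode k = (a, b)"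
    by fastforce
  then have k: "k = prod_encode (a, b)"
    by (metis prod_decode_inverse)
  have "2 * a \<noteq> 2 * j + 1" "2 * b + 1 \<noteq> 2 * i"
    by presburger+
  then have "x (2 * a) = (if a = i then of_real (real i powr - s) else 0)"
    and "x (2 * b + 1) = (if b = j then of_real (real j powr - s) else 0)"
    by (auto simp: x_def weighted_unit_def scl_l2 l2_unit_def)
  then show "l2_tensor x x k = weighted_unit s (i * j) (prod_encode (i, j)) k"
    using ab by (auto simp: l2_tensor_def weighted_unit_def scl_l2 l2_unit_def k powr_mult)
qed

lemma image_two_term_set:
  "(\<lambda>x. l2_tensor x x) ` two_term_set s = {weighted_unit s (i * j) (prod_encode (i, j)) |i j. True}"
proof (intro equalityI subsetI)
  fix y assume "y \<in> (\<lambda>x. l2_tensor x x) ` two_term_set s"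
  then obtain x where "x \<in> two_term_set s" "y = l2_tensor x x"
    by blast
  then show "y \<in> {weighted_unit s (i * j) (prod_encode (i, j)) |i j. True}"
    using l2_tensor_two_term by (blast elim: two_term_setE)
next
  fix y assume "y \<in> {weighted_unit s (i * j) (prod_encode (i, j)) |i j. True}"
  then obtain i j where "y = weighted_unit s (i * j) (prod_encode (i, j))"
    by blast
  then show "y \<in> (\<lambda>x. l2_tensor x x) ` two_term_set s"
    by (intro image_eqI[OF _ two_term_setI[of s i j]]) (simp only: l2_tensor_two_term)
qed

text \<open>Reduces the lower bound to counting: \<open>2 * n\<close> distinct coordinates whose
  vectors in \<open>A\<close> have index at most \<open>t\<close>, hence weight at least
  \<open>t powr - s\<close>.\<close>

lemma kolmogorov_width_l2_ge:
  assumes A: "A \<subseteq> vecs l2" "\<And>a. a \<in> A \<Longrightarrow> nrm l2 a \<le> M"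
    and J: "finite J" "2 * n \<le> card J" "1 \<le> n" "inj_on f J"
    and w: "\<And>k. k \<in> J \<Longrightarrow> \<exists>i. 0 < i \<and> i \<le> t \<and> weighted_unit s i (f k) \<in> A"
    and "0 < s" "0 < t"
  shows "t powr - s / sqrt 2 \<le> kolmogorov_width l2 A n"
proof (rule l2.kolmogorov_width_ge_orthonormal[OF A])
  have "inj_on (\<lambda>k. l2_unit (f k)) J"
    using J(4) inj_l2_unit by (auto simp: inj_on_def inj_def)
  then show "2 * n \<le> card (l2_unit ` f ` J)"
    using J by (simp add: card_image image_image)
  show "l2_unit ` f ` J \<noteq> {}"
    using J by auto
  fix e assume "e \<in> l2_unit ` f ` J"
  then obtain k where k: "k \<in> J" "e = l2_unit (f k)"
    by auto
  then obtain i where i: "0 < i" "real i \<le> t" "weighted_unit s i (f k) \<in> A"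
    using w by blast
  then show "\<exists>c. t powr - s \<le> cmod c \<and> scl l2 c e \<in> A"
    using k \<open>0 < s\<close> unfolding weighted_unit_def
    by (intro exI[of _ "of_real (real i powr - s)"]) (auto intro!: powr_mono2')
qed (use J orthonormal_l2_unit in auto)

lemma width_two_term_set:
  assumes s: "0 < s"
  shows "seq_comparable (kolmogorov_width l2 (two_term_set s)) (\<lambda>n. real n powr - s)"
proof (rule seq_comparableI)
  show "0 < 2 powr - s / sqrt 2"
    by simp
  show "0 < real 1 powr - s"
    by simp
  note bounded = two_term_set_bounded[OF _ s]
  fix n :: nat assume n: "1 \<le> n"
  have "(2 * real n) powr - s / sqrt 2 \<le> kolmogorov_width l2 (two_term_set s) n"
  proof (rule kolmogorov_width_l2_ge[where M = 2 and J = "{1..2 * n}" and f = "\<lambda>i. 2 * i"])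
    \<comment> \<open>Index 0 in the odd part makes that summand vanish, so the set contains the
      single vectors on even coordinates.\<close>
    fix k assume "k \<in> {1..2 * n}"
    then show "\<exists>i. 0 < i \<and> real i \<le> 2 * real n \<and> weighted_unit s i (2 * k) \<in> two_term_set s"
      using two_term_setI[of s k 0] by (intro exI[of _ k]) (auto simp: weighted_unit_0)
  qed (use n s bounded in \<open>auto simp: inj_on_def\<close>)
  then show "2 powr - s / sqrt 2 * real n powr - s \<le> kolmogorov_width l2 (two_term_set s) n"
    by (simp add: powr_mult)
  \<comment> \<open>If the coordinate of a nonzero summand is not among the first \<open>n\<close>,
    its index is at least \<open>n / 3\<close>: in the odd case
    \<open>n \<le> 2 * j + 1 \<le> 3 * j\<close> for \<open>j \<ge> 1\<close>, and in the even case
    \<open>n \<le> 2 * i\<close>.\<close>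
  define t where "t = real n / 3"
  have t: "t > 0"
    using n by (simp add: t_def)
  \<comment> \<open>Each of the two summands is approximated within
    \<open>t powr - s\<close>.\<close>
  have "kolmogorov_width l2 (two_term_set s) n \<le> 2 * t powr - s"
  proof (rule l2.kolmogorov_width_le)
    show "card (l2_unit ` {..<n}) \<le> n"
      using card_image_le[of "{..<n}" l2_unit] by simp
    show "\<exists>v\<in>l2.span (l2_unit ` {..<n}). nrm l2 (x - v) \<le> 2 * t powr - s"
      if x: "x \<in> two_term_set s" for x
    proof -
      obtain i j where x: "x = weighted_unit s i (2 * i) + weighted_unit s j (2 * j + 1)"
        using x two_term_setE by blast
      have i: "2 * i \<in> {..<n} \<or> i = 0 \<or> t \<le> real i"
        and j: "2 * j + 1 \<in> {..<n} \<or> j = 0 \<or> t \<le> real j"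
        by (auto simp: t_def)
      obtain v where v: "v \<in> l2.span (l2_unit ` {..<n})"
        "nrm l2 (weighted_unit s i (2 * i) - v) \<le> t powr - s"
        using weighted_unit_approx[OF i t s] by blast
      obtain w where w: "w \<in> l2.span (l2_unit ` {..<n})"
        "nrm l2 (weighted_unit s j (2 * j + 1) - w) \<le> t powr - s"
        using weighted_unit_approx[OF j t s] by blast
      have "l2.span (l2_unit ` {..<n}) \<subseteq> vecs l2"
        using l2_unit by (intro l2.span_minimal l2.subspace_vecs) auto
      then have vw: "v \<in> vecs l2" "w \<in> vecs l2"
        using v w by auto
      have "x - (v + w) = (weighted_unit s i (2 * i) - v) + (weighted_unit s j (2 * j + 1) - w)"
        by (simp add: x)
      then have "nrm l2 (x - (v + w)) \<le> nrm l2 (weighted_unit s i (2 * i) - v)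
          + nrm l2 (weighted_unit s j (2 * j + 1) - w)"
        using vw by (simp only:) (intro l2_add l2.vecs_closed weighted_unit)
      then show ?thesis
        using v w by (intro bexI[of _ "v + w"] l2.span_add) auto
    qed
    show "two_term_set s \<noteq> {}"
      using two_term_setI by blast
  qed (use bounded l2_unit in auto)
  then show "kolmogorov_width l2 (two_term_set s) n \<le> 2 * 3 powr s * real n powr - s"
    by (simp add: t_def powr_divide powr_minus field_simps)
qed

lemma width_image_two_term_set:
  assumes s: "0 < s"
  shows "seq_comparable (kolmogorov_width l2 ((\<lambda>x. l2_tensor x x) ` two_term_set s))
    (\<lambda>n. real n powr - s * ln (real n + 1) powr s)"
proof (rule seq_comparableI)
  show "0 < 16 powr - s / sqrt 2"
    by simp
  show "0 < real 1 powr - s * ln (real 1 + 1) powr s"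
    by simp
  define A where "A = (\<lambda>x. l2_tensor x x) ` two_term_set s"
  have A_eq: "A = {weighted_unit s (i * j) (prod_encode (i, j)) |i j. True}"
    unfolding A_def by (rule image_two_term_set)
  have A: "A \<subseteq> vecs l2" "\<And>a. a \<in> A \<Longrightarrow> nrm l2 a \<le> 1"
    unfolding A_eq using weighted_unit weight_le_1[OF s] by (auto simp del: of_nat_mult)
  fix n :: nat assume n: "1 \<le> n"
  define L where "L = ln (real n + 1)"
  have L: "1 / 2 \<le> L" "L \<le> n"
    unfolding L_def using ln_Suc_ge_half[OF n] ln_add_one_self_le_self[of "real n"]
    by (simp_all add: add.commute)
  have "(16 * n / L) powr - s / sqrt 2 \<le> kolmogorov_width l2 A n"
  proof -
    \<comment> \<open>This reaches the threshold at which the cross has \<open>2 * n\<close> pairs.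
      As \<open>L \<le> n\<close>, the number being rounded is at least 1, so rounding up at most
      doubles it; hence the 16.\<close>
    define N where "N = nat \<lceil>8 * n / L\<rceil>"
    have N: "8 * n / L \<le> real N" "real N \<le> 16 * n / L"
    proof -
      show "8 * n / L \<le> real N"
        unfolding N_def by linarith
      have "1 \<le> 8 * n / L"
        using L by (simp add: pos_le_divide_eq)
      moreover have "real N \<le> 8 * n / L + 1"
        unfolding N_def using calculation by linarith
      ultimately show "real N \<le> 16 * n / L"
        by simp
    qed
    show ?thesis
    proof (rule kolmogorov_width_l2_ge[OF A, where J = "hyperbolic_cross N" and f = prod_encode])
      show "2 * n \<le> card (hyperbolic_cross N)"
        using card_hyperbolic_cross_ge_2n[OF n] N(1) by (simp add: L_def)
      fix k assume k: "k \<in> hyperbolic_cross N"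
      obtain i j where ij: "k = (i, j)"
        by fastforce
      with k have "1 \<le> i * j" "i * j \<le> N"
        by (simp_all add: mem_hyperbolic_cross)
      moreover from this have "real (i * j) \<le> 16 * n / L"
        using N(2) by (meson of_nat_le_iff order_trans)
      ultimately show "\<exists>i. 0 < i \<and> real i \<le> 16 * n / L \<and> weighted_unit s i (prod_encode k) \<in> A"
        unfolding A_eq ij by (intro exI[of _ "i * j"]) auto
    qed (use n L s finite_hyperbolic_cross inj_prod_encode in \<open>auto simp: inj_on_def\<close>)
  qed
  then show "16 powr - s / sqrt 2 * (real n powr - s * ln (real n + 1) powr s)
      \<le> kolmogorov_width l2 ((\<lambda>x. l2_tensor x x) ` two_term_set s) n"
    using n L by (simp add: A_def L_def powr_mult powr_divide powr_minus field_simps)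
  \<comment> \<open>At this level the cross up to the integer part of \<open>t\<close> has at most
    \<open>n\<close> pairs, so its coordinates span an admissible subspace.\<close>
  define t where "t = real n / (3 * L)"
  have t: "t > 0"
    using n L by (simp add: t_def)
  have "kolmogorov_width l2 A n \<le> t powr - s"
  proof (rule l2.kolmogorov_width_le[OF A(1) _ A(2)])
    define N where "N = nat \<lfloor>t\<rfloor>"
    have N: "real N \<le> t" "t < real N + 1"
      unfolding N_def using t by linarith+
    show "A \<noteq> {}"
      by (auto simp: A_eq)
    have "card (l2_unit ` prod_encode ` hyperbolic_cross N) \<le> card (hyperbolic_cross N)"
      by (metis card_image_le finite_hyperbolic_cross image_image)
    also have "\<dots> \<le> n"
      using card_hyperbolic_cross_le_n[OF n] N(1) by (simp add: t_def L_def)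
    finally show "card (l2_unit ` prod_encode ` hyperbolic_cross N) \<le> n" .
    fix a assume "a \<in> A"
    then obtain i j where a: "a = weighted_unit s (i * j) (prod_encode (i, j))"
      unfolding A_eq by auto
    show "\<exists>v\<in>l2.span (l2_unit ` prod_encode ` hyperbolic_cross N). nrm l2 (a - v) \<le> t powr - s"
      unfolding a
    proof (rule weighted_unit_approx)
      \<comment> \<open>A positive product outside the cross is an integer above \<open>N\<close>,
        hence at least \<open>N + 1 > t\<close>.\<close>
      have "t \<le> real (i * j)" if "N + 1 \<le> i * j"
        using N(2) of_nat_mono[OF that, where 'a = real] by simp
      then show "prod_encode (i, j) \<in> prod_encode ` hyperbolic_cross N \<or> i * j = 0
          \<or> t \<le> real (i * j)"
        using mem_hyperbolic_cross[of i j N] by force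
    qed (use t s in auto)
  qed (use l2_unit finite_hyperbolic_cross in auto)
  then show "kolmogorov_width l2 ((\<lambda>x. l2_tensor x x) ` two_term_set s) n
      \<le> 3 powr s * (real n powr - s * ln (real n + 1) powr s)"
    using n L by (simp add: A_def t_def L_def powr_divide powr_mult powr_minus field_simps)
qed

theorem theorem1p3:
  fixes s :: real
  assumes "s > 0"
  shows "\<exists>(X :: (nat \<Rightarrow> complex) cspace) (Y :: (nat \<Rightarrow> complex) cspace) K U u.
    complex_hilbert_space X \<and> separable X \<and>
    complex_hilbert_space Y \<and> separable Y \<and>
    compactin (ctop X) K \<and> openin (ctop X) U \<and> K \<subseteq> U \<and>
    holomorphic_map X Y U u \<and>
    (\<exists>P. continuous_hom_poly 2 X Y P \<and> (\<forall>x\<in>U. u x = P x)) \<and>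
    (\<exists>M. \<forall>x\<in>U. nrm Y (u x) \<le> M) \<and>
    seq_comparable (kolmogorov_width X K) (\<lambda>n. real n powr (- s)) \<and>
    seq_comparable (kolmogorov_width Y (u ` K)) (\<lambda>n. real n powr (- s) * ln (real n + 1) powr s)"
proof -
  \<comment> \<open>The radius exceeds the norm bound 2 on \<open>two_term_set s\<close>; a bounded
    neighbourhood makes the quadratic map bounded, here by \<open>3 * 3\<close>.\<close>
  define U where "U = l2.metric.mball 0 3"
  have U_iff: "x \<in> U \<longleftrightarrow> x \<in> vecs l2 \<and> nrm l2 x < 3" for x
    using l2.nrm_minus_commute[of 0 x] by (auto simp: U_def l2.cdist_nrm l2.vecs_closed)
  have U: "openin (ctop l2) U"
    by (simp add: U_def ctop_def)
  have KU: "two_term_set s \<subseteq> U"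
    using two_term_set_bounded[OF _ assms] by (force simp: U_iff)
  have K: "compactin (ctop l2) (two_term_set s)"
    unfolding two_term_set_def
    by (intro l2.compactin_set_plus compactin_weighted_units assms)
  have bounded: "nrm l2 (l2_tensor x x) \<le> 9" if "x \<in> U" for x
  proof -
    have "nrm l2 (l2_tensor x x) \<le> nrm l2 x * nrm l2 x"
      using that by (intro l2_tensor) (auto simp: U_iff)
    also have "\<dots> \<le> 3 * 3"
      using that by (intro mult_mono nrm_l2_nonneg) (auto simp: U_iff)
    finally show ?thesis
      by simp
  qed
  show ?thesis
  proof (rule exI[of _ l2], rule exI[of _ l2], rule exI[of _ "two_term_set s"], rule exI[of _ U],
      rule exI[of _ "\<lambda>x. l2_tensor x x"], intro conjI)
    show "\<exists>P. continuous_hom_poly 2 l2 l2 P \<and> (\<forall>x\<in>U. l2_tensor x x = P x)"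
      using l2_tensor.continuous_hom_poly_diagonal by blast
    show "\<exists>M. \<forall>x\<in>U. nrm l2 (l2_tensor x x) \<le> M"
      using bounded by blast
  qed (use complex_hilbert_space_l2 separable_l2 K U KU width_two_term_set[OF assms]
      width_image_two_term_set[OF assms] l2_tensor.holomorphic_map_diagonal[OF U] in auto)
qed

end
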